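(* Let $\mathfrak{g}$ be a finite-dimensional simple complex Lie algebra with Cartan subalgebra $\mathfrak{h}$, Weyl group $W$, and dimension polynomial $D:\mathfrak{h}^\ast\to\mathbb{C}$ (the polynomial given by Weyl's dimension formula). For every $w\in W$ and every $\lambda\in\mathfrak{h}^\ast$, $$D(w\cdot\lambda)=(-1)^{\ell(w)}D(\lambda),$$ where $w\cdot\lambda=w(\lambda+\rho)-\rho$ is the shifted action of $w$ on $\lambda$ and $\ell(w)$ is the length of $w$.
   Context: Let $\mathfrak{g}$ be a finite-dimensional simple complex Lie algebra of rank $r$, with Cartan subalgebra $\mathfrak{h}$, root system $\Phi$, positive roots $\Phi_+$, simple roots $\alpha_1,\ldots,\alpha_r$, simple coroots $\alpha_1^\vee,\ldots,\alpha_r^\vee$, and fundamental weights $\omega_1,\ldots,\omega_r$ (dual to the simple coroots). Every $\lambda\in\mathfrak{h}^\ast$ is written $\lambda=\lambda_1\omega_1+\cdots+\lambda_r\omega_r$ with scalars $\lambda_i$ (Dynkin labels). The Weyl vector is $\rho=\tfrac12\sum_{\alpha\in\Phi_+}\alpha=\sum_{i=1}^r\omega_i$. The Weyl group $W$ is generated by the simple reflections $s_1,\ldots,s_r$, and $\ell(w)$ denotes the length of $w\in W$ with respect to these generators. The shifted action of $w\in W$ on $\lambda\in\mathfrak{h}^\ast$ is $w\cdot\lambda:=w(\lambda+\rho)-\rho$. The dimension polynomial $D$ is the polynomial in the $r$ variables $\lambda_1,\ldots,\lambda_r$, regarded as a function on $\mathfrak{h}^\ast$, obtained by expanding Weyl's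 dimension formula: $$D(\lambda)=\prod_{\alpha\in\Phi_+}\frac{\langle\alpha,\lambda+\rho\rangle}{\langle\alpha,\rho\rangle},$$ where $\langle\cdot,\cdot\rangle$ is the ($W$-invariant) symmetric bilinear form on $\mathfrak{h}^\ast$ induced by the Killing form. It agrees with $\dim L(\lambda)$ for every dominant integral weight $\lambda$, where $L(\lambda)$ is the irreducible highest-weight module of highest weight $\lambda$. *)

theory Defs
  imports
    Complex_Main
    "HOL-Library.Function_Algebras"
    "HOL-Algebra.Bij"
    "HOL-Algebra.Generated_Groups"
begin

text \<open>
  Linear functionals on a subspace \<open>H\<close> of a Lie algebra are functions on the whole type that are
  linear on \<open>H\<close> and zero outside \<open>H\<close>. The zero extension makes equality of functionals
  on \<open>H\<close> coincide with equality of functions, and it is compatible with the pointwise operations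
  of \<^theory>\<open>HOL-Library.Function_Algebras\<close>.
\<close>

definition fscale :: "complex \<Rightarrow> ('a \<Rightarrow> complex) \<Rightarrow> 'a \<Rightarrow> complex"
  where "fscale c f = (\<lambda>x. c * f x)"

interpretation fun_space: vector_space "fscale :: complex \<Rightarrow> ('a \<Rightarrow> complex) \<Rightarrow> 'a \<Rightarrow> complex"
  by unfold_locales (auto simp: fscale_def algebra_simps)

locale complex_lie_algebra =
  finite_dimensional_vector_space scale Basis
  for scale :: "complex \<Rightarrow> 'g::ab_group_add \<Rightarrow> 'g" (infixr \<open>*s\<close> 75)
    and Basis :: "'g set" +
  fixes bracket :: "'g \<Rightarrow> 'g \<Rightarrow> 'g"
  assumes bracket_linear_left: "Vector_Spaces.linear (*s) (*s) (\<lambda>x. bracket x y)"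
    and bracket_linear_right: "Vector_Spaces.linear (*s) (*s) (\<lambda>y. bracket x y)"
    and bracket_self: "bracket x x = 0"
    and jacobi: "bracket x (bracket y z) + bracket y (bracket z x) + bracket z (bracket x y) = 0"
begin

definition lie_ideal :: "'g set \<Rightarrow> bool"
  where "lie_ideal I \<longleftrightarrow> subspace I \<and> (\<forall>x. \<forall>y\<in>I. bracket x y \<in> I)"

definition diagonalizable :: "('g \<Rightarrow> 'g) \<Rightarrow> bool"
  where "diagonalizable f \<longleftrightarrow>
    (\<exists>B. independent B \<and> span B = UNIV \<and> (\<forall>b\<in>B. \<exists>c. f b = c *s b))"

text \<open>
  The usual definition for complex semisimple Lie algebras: an abelian subalgebra that is its own
  centralizer and whose elements are ad-diagonalizable.
\<close>

definition cartan_subalgebra :: "'g set \<Rightarrow> bool"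
  where "cartan_subalgebra H \<longleftrightarrow>
    subspace H \<and>
    (\<forall>x\<in>H. \<forall>y\<in>H. bracket x y = 0) \<and>
    (\<forall>x. (\<forall>h\<in>H. bracket h x = 0) \<longrightarrow> x \<in> H) \<and>
    (\<forall>h\<in>H. diagonalizable (bracket h))"

definition trace :: "('g \<Rightarrow> 'g) \<Rightarrow> complex"
  where "trace f = (\<Sum>b\<in>Basis. representation Basis (f b) b)"

definition killing_form :: "'g \<Rightarrow> 'g \<Rightarrow> complex"
  where "killing_form x y = trace (\<lambda>z. bracket x (bracket y z))"

definition dual_space :: "'g set \<Rightarrow> ('g \<Rightarrow> complex) set"
  where "dual_space H = {f.
    (\<forall>x\<in>H. \<forall>y\<in>H. f (x + y) = f x + f y) \<and>
    (\<forall>c. \<forall>x\<in>H. f (c *s x) = c * f x) \<and>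
    (\<forall>x. x \<notin> H \<longrightarrow> f x = 0)}"

definition killing_rep :: "'g set \<Rightarrow> ('g \<Rightarrow> complex) \<Rightarrow> 'g"
  where "killing_rep H f = (THE t. t \<in> H \<and> (\<forall>h\<in>H. killing_form t h = f h))"

definition dual_form :: "'g set \<Rightarrow> ('g \<Rightarrow> complex) \<Rightarrow> ('g \<Rightarrow> complex) \<Rightarrow> complex"
  where "dual_form H f g = killing_form (killing_rep H f) (killing_rep H g)"

definition roots :: "'g set \<Rightarrow> ('g \<Rightarrow> complex) set"
  where "roots H = {\<alpha> \<in> dual_space H.
    \<alpha> \<noteq> 0 \<and> (\<exists>x. x \<noteq> 0 \<and> (\<forall>h\<in>H. bracket h x = \<alpha> h *s x))}"

text \<open>
  \<open>simple_roots H \<Delta>\<close>: \<open>\<Delta>\<close> is a base of the root system, i.e. one of the possible choices of a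
  set of simple roots. The positive roots are those determined by \<open>\<Delta>\<close>.
\<close>

definition simple_roots :: "'g set \<Rightarrow> ('g \<Rightarrow> complex) set \<Rightarrow> bool"
  where "simple_roots H \<Delta> \<longleftrightarrow>
    \<Delta> \<subseteq> roots H \<and>
    fun_space.independent \<Delta> \<and> fun_space.span \<Delta> = dual_space H \<and>
    (\<forall>\<beta>\<in>roots H. \<exists>c :: ('g \<Rightarrow> complex) \<Rightarrow> nat.
       \<beta> = (\<Sum>\<alpha>\<in>\<Delta>. fscale (of_nat (c \<alpha>)) \<alpha>) \<or>
       \<beta> = - (\<Sum>\<alpha>\<in>\<Delta>. fscale (of_nat (c \<alpha>)) \<alpha>))"

definition positive_roots :: "'g set \<Rightarrow> ('g \<Rightarrow> complex) set \<Rightarrow> ('g \<Rightarrow> complex) set"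
  where "positive_roots H \<Delta> = {\<beta> \<in> roots H. \<exists>c :: ('g \<Rightarrow> complex) \<Rightarrow> nat.
    \<beta> = (\<Sum>\<alpha>\<in>\<Delta>. fscale (of_nat (c \<alpha>)) \<alpha>)}"

definition weyl_vector :: "'g set \<Rightarrow> ('g \<Rightarrow> complex) set \<Rightarrow> 'g \<Rightarrow> complex"
  where "weyl_vector H \<Delta> = fscale (1 / 2) (\<Sum>\<alpha>\<in>positive_roots H \<Delta>. \<alpha>)"

definition coroot :: "'g set \<Rightarrow> ('g \<Rightarrow> complex) \<Rightarrow> 'g"
  where "coroot H \<alpha> = (2 / dual_form H \<alpha> \<alpha>) *s killing_rep H \<alpha>"

definition reflection ::
    "'g set \<Rightarrow> ('g \<Rightarrow> complex) \<Rightarrow> ('g \<Rightarrow> complex) \<Rightarrow> 'g \<Rightarrow> complex"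
  where "reflection H \<alpha> = (\<lambda>f\<in>dual_space H. f - fscale (f (coroot H \<alpha>)) \<alpha>)"

text \<open>The Weyl group consists of extensional bijections of \<open>dual_space H\<close>.\<close>

definition weyl_group ::
    "'g set \<Rightarrow> ('g \<Rightarrow> complex) set \<Rightarrow> (('g \<Rightarrow> complex) \<Rightarrow> 'g \<Rightarrow> complex) set"
  where "weyl_group H \<Delta> = generate (BijGroup (dual_space H)) (reflection H ` \<Delta>)"

definition weyl_word ::
    "'g set \<Rightarrow> ('g \<Rightarrow> complex) list \<Rightarrow> ('g \<Rightarrow> complex) \<Rightarrow> 'g \<Rightarrow> complex"
  where "weyl_word H as =
    foldr (\<lambda>\<alpha> w. reflection H \<alpha> \<otimes>\<^bsub>BijGroup (dual_space H)\<^esub> w) as \<one>\<^bsub>BijGroup (dual_space H)\<^esub>"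

definition weyl_length ::
    "'g set \<Rightarrow> ('g \<Rightarrow> complex) set \<Rightarrow> (('g \<Rightarrow> complex) \<Rightarrow> 'g \<Rightarrow> complex) \<Rightarrow> nat"
  where "weyl_length H \<Delta> w =
    (LEAST n. \<exists>as. set as \<subseteq> \<Delta> \<and> length as = n \<and> weyl_word H as = w)"

definition shifted_action ::
    "'g set \<Rightarrow> ('g \<Rightarrow> complex) set \<Rightarrow> (('g \<Rightarrow> complex) \<Rightarrow> 'g \<Rightarrow> complex) \<Rightarrow>
     ('g \<Rightarrow> complex) \<Rightarrow> 'g \<Rightarrow> complex"
  where "shifted_action H \<Delta> w \<mu> = w (\<mu> + weyl_vector H \<Delta>) - weyl_vector H \<Delta>"

definition dimension_polynomial ::
    "'g set \<Rightarrow> ('g \<Rightarrow> complex) set \<Rightarrow> ('g \<Rightarrow> complex) \<Rightarrow> complex"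
  where "dimension_polynomial H \<Delta> \<mu> =
    (\<Prod>\<alpha>\<in>positive_roots H \<Delta>.
       dual_form H \<alpha> (\<mu> + weyl_vector H \<Delta>) / dual_form H \<alpha> (weyl_vector H \<Delta>))"

end

locale simple_complex_lie_algebra = complex_lie_algebra +
  assumes nonabelian: "\<exists>x y. bracket x y \<noteq> 0"
    and ideal_trivial: "lie_ideal I \<Longrightarrow> I = {0} \<or> I = UNIV"

end

theory Submission
  imports Defs
begin

text \<open>
  The dimension polynomial is \<open>P(\<lambda> + \<rho>) / P(\<rho>)\<close> with \<open>P(\<lambda>) = \<Prod> (\<beta>, \<lambda>)\<close>, the product running over the
  positive roots, and the shifted action of \<open>w\<close> becomes the ordinary action on \<open>\<lambda> + \<rho>\<close>. So the claim
  is that \<open>P\<close> is antisymmetric under the Weyl group. A simple reflection \<open>s\<close> is self-adjoint, which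
  gives \<open>P(s \<lambda>) = \<Prod> (s \<beta>, \<lambda>)\<close>; it maps its own simple root \<open>\<alpha>\<close> to \<open>-\<alpha>\<close> and permutes the other positive
  roots, so \<open>P(s \<lambda>) = - P(\<lambda>)\<close> (\<open>positive_root_product_reflection\<close>). A word of minimal length for \<open>w\<close> gives the
  sign.

  The substance is the structure theory behind this: roots are finite in number and permuted by the
  reflections (\<open>reflected_root\<close>), no positive integral multiple of a root other than itself is a
  root (\<open>root_multiple\<close>), and the Killing form identifies \<open>H\<close> with its dual. Since elements of \<open>H\<close>
  are diagonalizable and \<open>H\<close> is its own centralizer, the algebra is spanned by weight vectors, with \<open>H\<close> as the space of weight zero.
  Opposite root vectors \<open>x\<close>, \<open>y\<close> together with \<open>h = [x, y]\<close> satisfy the relations of \<open>sl(2)\<close> up to scaling, and the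
  computation with highest weight vectors shows that every weight takes at \<open>h\<close> a rational multiple
  of the value \<open>\<alpha>(h)\<close>, where \<open>\<alpha>\<close> is the weight of \<open>x\<close>. If the Killing form vanished, positivity of sums of
  squares would then force all these \<open>h\<close> to be zero, and simplicity would be contradicted
  (\<open>killing_nonzero\<close>). So the form is nondegenerate, each root has an \<open>sl(2)\<close> triple with \<open>h\<close> the
  coroot, and the statements about roots follow from the strings of that triple.
\<close>

context complex_lie_algebra
begin

section \<open>The Lie bracket and the Killing form\<close>

lemma bracket_add_left: "bracket (x + y) z = bracket x z + bracket y z"
  using bracket_linear_left[of z] by (simp add: Vector_Spaces.linear_iff)

lemma bracket_add_right: "bracket x (y + z) = bracket x y + bracket x z"
  using bracket_linear_right[of x] by (simp add: Vector_Spaces.linear_iff)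

lemma bracket_scale_left: "bracket (c *s x) z = c *s bracket x z"
  using bracket_linear_left[of z] by (simp add: Vector_Spaces.linear_iff)

lemma bracket_scale_right: "bracket x (c *s y) = c *s bracket x y"
  using bracket_linear_right[of x] by (simp add: Vector_Spaces.linear_iff)

lemma bracket_zero_left [simp]: "bracket 0 x = 0"
  using bracket_scale_left[of 0 0 x] by simp

lemma bracket_zero_right [simp]: "bracket x 0 = 0"
  using bracket_scale_right[of x 0 0] by simp

lemma bracket_minus_left: "bracket (- x) y = - bracket x y"
  using bracket_scale_left[of "-1" x y] by simp

lemma bracket_minus_right: "bracket x (- y) = - bracket x y"
  using bracket_scale_right[of x "-1" y] by simp

lemma bracket_diff_left: "bracket (x - y) z = bracket x z - bracket y z"
  using bracket_add_left[of x "- y" z] by (simp add: bracket_minus_left)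

lemma bracket_diff_right: "bracket x (y - z) = bracket x y - bracket x z"
  using bracket_add_right[of x y "- z"] by (simp add: bracket_minus_right)

lemma bracket_sum_right: "bracket x (sum f A) = (\<Sum>a\<in>A. bracket x (f a))"
  by (induction A rule: infinite_finite_induct) (auto simp: bracket_add_right)

lemmas bracket_simps = bracket_add_left bracket_add_right bracket_scale_left bracket_scale_right
  bracket_minus_left bracket_minus_right bracket_diff_left bracket_diff_right

lemma bracket_swap: "bracket y x = - bracket x y"
proof -
  have "0 = bracket (x + y) (x + y)" by (simp only: bracket_self)
  also have "\<dots> = bracket y x + bracket x y"
    by (simp only: bracket_add_left bracket_add_right) (simp add: bracket_self)
  finally show ?thesis by (simp add: eq_neg_iff_add_eq_0)
qed

lemma bracket_commutator: "bracket (bracket x y) z = bracket x (bracket y z) - bracket y (bracket x z)"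
proof -
  have "bracket z (bracket x y) = - (bracket x (bracket y z) + bracket y (bracket z x))"
    using jacobi[of x y z] by (subst eq_neg_iff_add_eq_0) (simp add: ac_simps)
  then show ?thesis
    using bracket_swap[of "bracket x y" z] bracket_swap[of x z] by (simp add: bracket_minus_right)
qed

lemma linear_bracket_bracket: "Vector_Spaces.linear (*s) (*s) (\<lambda>z. bracket x (bracket y z))"
  by (simp add: Vector_Spaces.linear_iff bracket_simps vector_space_axioms)

text \<open>
  Expanding \<open>g b\<close> in \<open>C\<close> turns the left side into a double sum over the entries of the two
  matrices, which is symmetric in the two maps. With \<open>B = C\<close> this is \<open>tr (f g) = tr (g f)\<close>; with
  \<open>g = id\<close> it says that the trace can be computed in any basis.
\<close>

lemma trace_commute_bases:
  assumes B: "independent B" "span B = UNIV" "finite B"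
    and C: "independent C" "span C = UNIV" "finite C"
    and f: "Vector_Spaces.linear (*s) (*s) f" and g: "Vector_Spaces.linear (*s) (*s) g"
  shows "(\<Sum>b\<in>B. representation B (f (g b)) b) = (\<Sum>c\<in>C. representation C (g (f c)) c)"
proof -
  have expand: "representation B' (f' (g' b)) b = (\<Sum>c\<in>C'. representation C' (g' b) c * representation B' (f' c) b)"
    if "independent B'" "span B' = UNIV" "independent C'" "span C' = UNIV" "finite C'"
      "Vector_Spaces.linear (*s) (*s) f'" for B' C' f' g' b
  proof -
    interpret f': Vector_Spaces.linear "(*s)" "(*s)" f' by fact
    have "f' (g' b) = f' (\<Sum>c\<in>C'. representation C' (g' b) c *s c)"
      using that by (subst sum_representation_eq) auto
    also have "\<dots> = (\<Sum>c\<in>C'. representation C' (g' b) c *s f' c)"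
      by (simp add: f'.sum f'.scale)
    finally show ?thesis
      using that by (simp add: representation_sum representation_scale)
  qed
  have "(\<Sum>b\<in>B. representation B (f (g b)) b)
      = (\<Sum>b\<in>B. \<Sum>c\<in>C. representation C (g b) c * representation B (f c) b)"
    using B C f by (intro sum.cong refl expand) auto
  also have "\<dots> = (\<Sum>c\<in>C. \<Sum>b\<in>B. representation B (f c) b * representation C (g b) c)"
    by (subst sum.swap) (simp add: mult.commute)
  also have "\<dots> = (\<Sum>c\<in>C. representation C (g (f c)) c)"
    using B C g by (intro sum.cong refl expand[symmetric]) auto
  finally show ?thesis .
qed

lemma trace_commute:
  assumes "Vector_Spaces.linear (*s) (*s) f" "Vector_Spaces.linear (*s) (*s) g"
  shows "trace (\<lambda>x. f (g x)) = trace (\<lambda>x. g (f x))"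
  unfolding trace_def
  by (intro trace_commute_bases assms independent_Basis span_Basis finite_Basis)

lemma trace_basis:
  assumes "independent B" "span B = UNIV" "finite B" "Vector_Spaces.linear (*s) (*s) f"
  shows "trace f = (\<Sum>b\<in>B. representation B (f b) b)"
  using trace_commute_bases[OF independent_Basis span_Basis finite_Basis assms(1-3) assms(4) linear_id]
  unfolding trace_def by simp

lemma trace_add: "trace (\<lambda>x. f x + g x) = trace f + trace g"
  unfolding trace_def
  by (simp add: representation_add independent_Basis span_Basis sum.distrib)

lemma trace_scale: "trace (\<lambda>x. c *s f x) = c * trace f"
  unfolding trace_def
  by (simp add: representation_scale independent_Basis span_Basis sum_distrib_left)

lemma trace_diff: "trace (\<lambda>x. f x - g x) = trace f - trace g"
  unfolding trace_def
  by (simp add: representation_diff independent_Basis span_Basis sum_subtractf)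

lemma killing_add_left: "killing_form (x + y) z = killing_form x z + killing_form y z"
  unfolding killing_form_def by (simp add: bracket_simps trace_add)

lemma killing_scale_left: "killing_form (c *s x) z = c * killing_form x z"
  unfolding killing_form_def by (simp add: bracket_simps trace_scale)

lemma killing_commute: "killing_form x y = killing_form y x"
  unfolding killing_form_def using trace_commute[OF bracket_linear_right bracket_linear_right] .

lemma killing_add_right: "killing_form z (x + y) = killing_form z x + killing_form z y"
  by (metis killing_add_left killing_commute)

lemma killing_scale_right: "killing_form z (c *s x) = c * killing_form z x"
  by (metis killing_scale_left killing_commute)

lemma killing_zero [simp]: "killing_form 0 x = 0" "killing_form x 0 = 0"
  using killing_scale_left[of 0 0 x] killing_scale_right[of x 0 0] by auto

text \<open>
  Both sides are traces of \<open>ad x ad y ad z\<close> minus a product in a different order, and the two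
  subtracted products differ by a cyclic permutation.
\<close>

lemma killing_invariant: "killing_form (bracket x y) z = killing_form x (bracket y z)"
proof -
  have "trace (\<lambda>v. bracket y (bracket x (bracket z v))) = trace (\<lambda>v. bracket x (bracket z (bracket y v)))"
    using trace_commute[OF bracket_linear_right[of y] linear_bracket_bracket[of x z]] .
  then show ?thesis
    unfolding killing_form_def by (simp add: bracket_commutator bracket_diff_right trace_diff)
qed

section \<open>Weight vectors\<close>

text \<open>
  The common eigenspaces of the operators \<open>ad h\<close> with \<open>h\<close> in \<open>T\<close>. For a Cartan subalgebra \<open>T\<close> and a
  root \<open>f\<close> this is the root space. Arbitrary sets \<open>T\<close> are allowed so that simultaneous eigenvectors
  can be built by adding one element of the Cartan subalgebra at a time, and \<open>T = {h}\<close> gives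
  the eigenspaces of a single operator.
\<close>

definition weight_space :: "'g set \<Rightarrow> ('g \<Rightarrow> complex) \<Rightarrow> 'g set"
  where "weight_space T f = {v. \<forall>h\<in>T. bracket h v = f h *s v}"

lemma subspace_weight_space: "subspace (weight_space T f)"
  by (auto simp: weight_space_def subspace_def bracket_simps scale_right_distrib)

lemma weight_space_bracket:
  assumes "x \<in> weight_space T f" "y \<in> weight_space T g"
  shows "bracket x y \<in> weight_space T (f + g)"
proof -
  have "bracket h (bracket x y) = (f h + g h) *s bracket x y" if "h \<in> T" for h
    using assms that bracket_commutator[of h x y]
    by (simp add: weight_space_def bracket_simps scale_left_distrib)
  then show ?thesis by (simp add: weight_space_def)
qed

text \<open>
  The usual argument for eigenvectors: applying \<open>ad h - g h\<close> to a vanishing sum removes the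
  summand of weight \<open>g\<close> and multiplies the one of weight \<open>f\<close> by \<open>f h - g h\<close>, so the sum gets shorter,
  and since \<open>f\<close> and \<open>g\<close> are separated by \<open>T\<close> some \<open>h\<close> makes that factor nonzero.
\<close>

lemma weight_vectors_independent:
  assumes "finite C" "\<And>f. f \<in> C \<Longrightarrow> u f \<in> weight_space T f"
    and "\<And>f g. f \<in> C \<Longrightarrow> g \<in> C \<Longrightarrow> f \<noteq> g \<Longrightarrow> \<exists>h\<in>T. f h \<noteq> g h"
    and "(\<Sum>f\<in>C. u f) = 0" "f \<in> C"
  shows "u f = 0"
  using assms
proof (induction C arbitrary: u f rule: finite_induct)
  case empty
  then show ?case by simp
next
  case (insert g C)
  \<comment> \<open>The difference of \<open>ad h\<close> and \<open>g h\<close>, applied to the given sum, has one summand less.\<close>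
  have vanish: "u f = 0" if f: "f \<in> C" for f
  proof -
    have "(f h - g h) *s u f = 0" if h: "h \<in> T" for h
    proof (rule insert.IH[where u = "\<lambda>f. (f h - g h) *s u f"])
      show "(f' h - g h) *s u f' \<in> weight_space T f'" if "f' \<in> C" for f'
        using insert.prems(1) that by (intro subspace_scale[OF subspace_weight_space]) auto
      have ug: "u g = - (\<Sum>f\<in>C. u f)"
        using insert.prems(3) insert.hyps by (simp add: add_eq_0_iff2)
      have "g h *s u g = bracket h (u g)"
        using insert.prems(1)[of g] h by (simp add: weight_space_def)
      also have "\<dots> = - (\<Sum>f\<in>C. f h *s u f)"
        using insert.prems(1) h
        by (simp add: ug bracket_minus_right bracket_sum_right weight_space_def)
      finally show "(\<Sum>f\<in>C. (f h - g h) *s u f) = 0"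
        by (simp add: ug scale_left_diff_distrib sum_subtractf scale_sum_right)
    qed (use insert.prems f in auto)
    moreover obtain h where "h \<in> T" "f h \<noteq> g h"
      using insert.prems(2)[of f g] f insert.hyps by blast
    ultimately show ?thesis by auto
  qed
  moreover have "u g = 0"
    using insert.prems(3) insert.hyps vanish by simp
  ultimately show ?case using insert.prems(4) by auto
qed

lemma eigenvectors_independent:
  assumes "finite C" "\<And>c. c \<in> C \<Longrightarrow> bracket h (u c) = c *s u c" "(\<Sum>c\<in>C. u c) = 0" "c \<in> C"
  shows "u c = 0"
proof -
  have inj: "inj_on (\<lambda>c (_::'g). c) C" by (auto simp: inj_on_def fun_eq_iff)
  have "(\<lambda>f. u (f h)) (\<lambda>_. c) = 0"
    using assms
    by (intro weight_vectors_independent[where C = "(\<lambda>c _. c) ` C" and T = "{h}"])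
      (auto simp: weight_space_def sum.reindex[OF inj])
  then show ?thesis by simp
qed

text \<open>
  Commuting diagonalizable operators are simultaneously diagonalizable. When \<open>h\<close> is added to
  \<open>T\<close>, a \<open>T\<close>-eigenvector \<open>v\<close> is decomposed into eigenvectors \<open>u d\<close> of \<open>ad h\<close>. Each \<open>s\<close> in \<open>T\<close> preserves the
  eigenspaces of \<open>ad h\<close>, so the components of \<open>[s, v] - f s v = 0\<close> vanish separately, which means that
  every \<open>u d\<close> still has the same eigenvalues on \<open>T\<close> as \<open>v\<close>.
\<close>

lemma simultaneous_eigenvectors_span:
  assumes "finite T" "\<And>s t. s \<in> T \<Longrightarrow> t \<in> T \<Longrightarrow> bracket s t = 0" "\<And>t. t \<in> T \<Longrightarrow> diagonalizable (bracket t)"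
  shows "span (\<Union>f. weight_space T f) = UNIV"
  using assms
proof (induction T rule: finite_induct)
  case empty
  have "weight_space {} f = UNIV" for f by (auto simp: weight_space_def)
  then show ?case by simp
next
  case (insert h T)
  have "v \<in> span (\<Union>f. weight_space (insert h T) f)" if v: "v \<in> weight_space T f" for v f
  proof -
    obtain B where B: "independent B" "span B = UNIV" "\<forall>b\<in>B. \<exists>c. bracket h b = c *s b"
      using insert.prems(2)[of h] unfolding diagonalizable_def by auto
    obtain c where c: "bracket h b = c b *s b" if "b \<in> B" for b
      using B(3) by metis
    have "v \<in> span B" using B by simp
    then obtain t r where t: "finite t" "t \<subseteq> B" "v = (\<Sum>b\<in>t. r b *s b)"
      unfolding span_explicit by blast
    \<comment> \<open>Collecting the expansion of \<open>v\<close> by eigenvalue gives its components \<open>u d\<close>.\<close>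
    define u where "u d = (\<Sum>b\<in>{b \<in> t. c b = d}. r b *s b)" for d
    have vu: "v = (\<Sum>d\<in>c ` t. u d)"
      unfolding u_def t(3) using t(1) by (rule sum.image_gen)
    have hu: "bracket h (u d) = d *s u d" for d
      unfolding u_def bracket_sum_right scale_sum_right
      using t(2) c by (intro sum.cong) (auto simp: bracket_scale_right mult.commute)
    have su: "bracket s (u d) - f s *s u d = 0" if s: "s \<in> T" and d: "d \<in> c ` t" for s d
    proof (rule eigenvectors_independent[where u = "\<lambda>d. bracket s (u d) - f s *s u d"])
      show "finite (c ` t)" using t by simp
      show "bracket h (bracket s (u d) - f s *s u d) = d *s (bracket s (u d) - f s *s u d)" for d
        using bracket_commutator[of h s "u d"] insert.prems(1)[of h s] s
        by (simp add: bracket_simps hu scale_right_diff_distrib mult.commute)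
      have "(\<Sum>d\<in>c ` t. bracket s (u d) - f s *s u d) = bracket s v - f s *s v"
        by (simp add: vu bracket_sum_right scale_sum_right sum_subtractf)
      also have "\<dots> = 0" using v s by (simp add: weight_space_def)
      finally show "(\<Sum>d\<in>c ` t. bracket s (u d) - f s *s u d) = 0" .
    qed (use d in auto)
    have "u d \<in> weight_space (insert h T) (f(h := d))" if "d \<in> c ` t" for d
      using su[OF _ that] hu insert.hyps by (auto simp: weight_space_def)
    then show ?thesis
      unfolding vu by (intro span_sum span_base) blast
  qed
  then have "span (\<Union>f. weight_space T f) \<subseteq> span (\<Union>f. weight_space (insert h T) f)"
    by (intro span_minimal) auto
  then show ?case using insert by auto
qed

lemma span_weight_spaces_sum:
  assumes "finite C" "v \<in> span (\<Union>f\<in>C. weight_space T f)"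
  obtains u where "\<And>f. f \<in> C \<Longrightarrow> u f \<in> weight_space T f" "v = (\<Sum>f\<in>C. u f)"
proof -
  let ?S = "{v. \<exists>u. (\<forall>f\<in>C. u f \<in> weight_space T f) \<and> v = (\<Sum>f\<in>C. u f)}"
  have "subspace ?S"
    unfolding subspace_def
  proof (intro conjI ballI allI)
    show "0 \<in> ?S"
      using subspace_0[OF subspace_weight_space] by (auto intro!: exI[of _ "\<lambda>_. 0"])
  next
    fix x y assume "x \<in> ?S" "y \<in> ?S"
    then obtain u u' where "\<forall>f\<in>C. u f \<in> weight_space T f" "x = (\<Sum>f\<in>C. u f)"
      "\<forall>f\<in>C. u' f \<in> weight_space T f" "y = (\<Sum>f\<in>C. u' f)" by blast
    then show "x + y \<in> ?S"
      using subspace_add[OF subspace_weight_space]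
      by (auto simp: sum.distrib intro!: exI[of _ "\<lambda>f. u f + u' f"])
  next
    fix c x assume "x \<in> ?S"
    then obtain u where "\<forall>f\<in>C. u f \<in> weight_space T f" "x = (\<Sum>f\<in>C. u f)" by blast
    then show "c *s x \<in> ?S"
      using subspace_scale[OF subspace_weight_space]
      by (auto simp: scale_sum_right intro!: exI[of _ "\<lambda>f. c *s u f"])
  qed
  moreover have "(\<Union>f\<in>C. weight_space T f) \<subseteq> ?S"
  proof safe
    fix g x assume "g \<in> C" "x \<in> weight_space T g"
    then show "\<exists>u. (\<forall>f\<in>C. u f \<in> weight_space T f) \<and> x = (\<Sum>f\<in>C. u f)"
      using assms(1) subspace_0[OF subspace_weight_space]
      by (intro exI[of _ "\<lambda>f. if f = g then x else 0"]) auto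
  qed
  ultimately have "v \<in> ?S" using assms(2) span_minimal by blast
  then show ?thesis using that by blast
qed

section \<open>Strings of weight vectors\<close>

text \<open>
  The parameter \<open>a\<close> is left free, including \<open>a = 0\<close>: a bracket \<open>[x, y]\<close> of opposite root vectors
  satisfies these relations before it is known that it acts on \<open>x\<close> by a nonzero scalar. The
  standard normalization of \<open>sl(2)\<close> is \<open>a = 2\<close>.
\<close>

definition sl2_triple :: "'g \<Rightarrow> 'g \<Rightarrow> 'g \<Rightarrow> complex \<Rightarrow> bool"
  where "sl2_triple x y h a \<longleftrightarrow> bracket x y = h \<and> bracket h x = a *s x \<and> bracket h y = - a *s y"

lemma sl2_triple_swap: "sl2_triple x y h a \<Longrightarrow> sl2_triple y x (- h) a"
  by (auto simp: sl2_triple_def bracket_simps bracket_swap[of x y])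

lemma iterate_raise_weight:
  assumes "bracket h x = a *s x" "bracket h v = c *s v"
  shows "bracket h ((bracket x ^^ k) v) = (c + of_nat k * a) *s (bracket x ^^ k) v"
proof (induction k)
  case 0
  then show ?case using assms by simp
next
  case (Suc k)
  then show ?case
    using bracket_commutator[of h x "(bracket x ^^ k) v"] assms
    by (simp add: bracket_simps algebra_simps)
qed

text \<open>
  Moving \<open>x\<close> to the right past the operators \<open>ad y\<close> picks up the weights \<open>m - j a\<close> for \<open>j \<le> k\<close>, and the
  coefficient is their sum.
\<close>

lemma sl2_raise_lowered:
  assumes "sl2_triple x y h a" "bracket x v = 0" "bracket h v = m *s v"
  shows "bracket x ((bracket y ^^ Suc k) v)
    = (of_nat (Suc k) * (m - of_nat k * a / 2)) *s (bracket y ^^ k) v"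
proof (induction k)
  case 0
  then show ?case
    using bracket_commutator[of x y v] assms by (simp add: sl2_triple_def)
next
  case (Suc k)
  let ?w = "(bracket y ^^ Suc k) v"
  have "bracket x (bracket y ?w) = bracket h ?w + bracket y (bracket x ?w)"
    using bracket_commutator[of x y ?w] assms by (simp add: sl2_triple_def)
  also have "bracket h ?w = (m - of_nat (Suc k) * a) *s ?w"
    using iterate_raise_weight[of h y "- a" v m "Suc k"] assms by (simp add: sl2_triple_def)
  also have "bracket y (bracket x ?w) = (of_nat (Suc k) * (m - of_nat k * a / 2)) *s ?w"
    unfolding Suc.IH by (simp add: bracket_scale_right)
  also have "(m - of_nat (Suc k) * a) *s ?w + (of_nat (Suc k) * (m - of_nat k * a / 2)) *s ?w
     = (m - of_nat (Suc k) * a + of_nat (Suc k) * (m - of_nat k * a / 2)) *s ?w"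
    by (simp only: scale_left_distrib)
  also have "m - of_nat (Suc k) * a + of_nat (Suc k) * (m - of_nat k * a / 2)
     = of_nat (Suc (Suc k)) * (m - of_nat (Suc k) * a / 2)"
    by (simp add: field_simps)
  finally show ?case by simp
qed

text \<open>
  The string below \<open>v\<close> ends at some last nonzero vector, with index \<open>k\<close>. Raising the zero vector that
  follows it must give zero, and by \<open>sl2_raise_lowered\<close> this forces \<open>m = k a / 2\<close>. For \<open>a = 0\<close> the
  conclusion is \<open>m = 0\<close>.
\<close>

lemma sl2_highest_weight:
  assumes "sl2_triple x y h a" "bracket x v = 0" "bracket h v = m *s v" "v \<noteq> 0"
    and "(bracket y ^^ n) v = 0"
  obtains k where "m = of_nat k * a / 2" "\<And>j. j \<le> k \<Longrightarrow> (bracket y ^^ j) v \<noteq> 0"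
proof -
  define N where "N = (LEAST n. (bracket y ^^ n) v = 0)"
  have N: "(bracket y ^^ N) v = 0" unfolding N_def by (rule LeastI) fact
  have least: "(bracket y ^^ j) v \<noteq> 0" if "j < N" for j
    using not_less_Least that unfolding N_def by blast
  have "N \<noteq> 0" using N assms(4) by (intro notI) simp
  then obtain k where k: "N = Suc k" by (auto simp: gr0_conv_Suc)
  have "(of_nat (Suc k) * (m - of_nat k * a / 2)) *s (bracket y ^^ k) v = 0"
    using sl2_raise_lowered[OF assms(1-3), of k] N k by simp
  then have "of_nat (Suc k) * (m - of_nat k * a / 2) = 0"
    using least[of k] k by (simp only: scale_eq_0_iff) simp
  then have "m = of_nat k * a / 2"
    by (simp only: mult_eq_0_iff of_nat_eq_0_iff) simp
  moreover have "(bracket y ^^ j) v \<noteq> 0" if "j \<le> k" for j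
    using least[of j] k that by simp
  ultimately show ?thesis using that by blast
qed

text \<open>
  Raising \<open>v\<close> as far as possible produces a highest weight vector after \<open>p\<close> steps.
\<close>

lemma sl2_string:
  assumes "sl2_triple x y h a" "bracket h v = c *s v" "v \<noteq> 0"
    and "(bracket x ^^ n) v = 0" and "\<And>p. \<exists>n. (bracket y ^^ n) ((bracket x ^^ p) v) = 0"
  obtains p k where "c + of_nat p * a = of_nat k * a / 2"
    "\<And>j. j \<le> k \<Longrightarrow> (bracket y ^^ j) ((bracket x ^^ p) v) \<noteq> 0"
proof -
  define N where "N = (LEAST n. (bracket x ^^ n) v = 0)"
  have N: "(bracket x ^^ N) v = 0" unfolding N_def by (rule LeastI) fact
  have "N \<noteq> 0" using N assms(3) by (intro notI) simp
  then obtain p where p: "N = Suc p" by (auto simp: gr0_conv_Suc)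
  have nz: "(bracket x ^^ p) v \<noteq> 0"
    using not_less_Least[of p "\<lambda>n. (bracket x ^^ n) v = 0"] p unfolding N_def by simp
  have wt: "bracket h ((bracket x ^^ p) v) = (c + of_nat p * a) *s (bracket x ^^ p) v"
    using assms by (intro iterate_raise_weight) (auto simp: sl2_triple_def)
  have top: "bracket x ((bracket x ^^ p) v) = 0"
    using N p by simp
  obtain n where n: "(bracket y ^^ n) ((bracket x ^^ p) v) = 0" using assms(5) by blast
  show ?thesis
    using sl2_highest_weight[OF assms(1) top wt nz n] that by metis
qed

end

section \<open>The weight decomposition for a Cartan subalgebra\<close>

locale simple_lie_algebra_with_cartan = simple_complex_lie_algebra +
  fixes H :: "'a set"
  assumes cartan: "cartan_subalgebra H"
begin

lemma subspace_cartan: "subspace H"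
  using cartan unfolding cartan_subalgebra_def by (elim conjE)

lemma cartan_abelian: "h \<in> H \<Longrightarrow> h' \<in> H \<Longrightarrow> bracket h h' = 0"
  using cartan unfolding cartan_subalgebra_def by (elim conjE) metis

lemma cartan_self_centralizing: "(\<And>h. h \<in> H \<Longrightarrow> bracket h x = 0) \<Longrightarrow> x \<in> H"
  using cartan unfolding cartan_subalgebra_def by (elim conjE) metis

lemma cartan_diagonalizable: "h \<in> H \<Longrightarrow> diagonalizable (bracket h)"
  using cartan unfolding cartan_subalgebra_def by (elim conjE) metis

text \<open>
  The center is an ideal, and it is proper because the algebra is not abelian.
\<close>

lemma center_trivial:
  assumes "\<And>x. bracket z x = 0"
  shows "z = 0"
proof -
  let ?Z = "{z. \<forall>x. bracket z x = 0}"
  have "lie_ideal ?Z"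
    by (auto simp: lie_ideal_def subspace_def bracket_simps) (metis bracket_swap neg_equal_0_iff_equal bracket_zero_left)
  then have "?Z = {0} \<or> ?Z = UNIV" by (rule ideal_trivial)
  moreover have "?Z \<noteq> UNIV" using nonabelian by blast
  ultimately show ?thesis using assms by blast
qed

lemma dual_space_add: "f \<in> dual_space H \<Longrightarrow> g \<in> dual_space H \<Longrightarrow> f + g \<in> dual_space H"
  by (simp add: dual_space_def algebra_simps)

lemma dual_space_fscale: "f \<in> dual_space H \<Longrightarrow> fscale c f \<in> dual_space H"
  by (simp add: dual_space_def fscale_def algebra_simps)

lemma dual_space_minus: "f \<in> dual_space H \<Longrightarrow> - f \<in> dual_space H"
  by (simp add: dual_space_def)

lemma dual_space_diff: "f \<in> dual_space H \<Longrightarrow> g \<in> dual_space H \<Longrightarrow> f - g \<in> dual_space H"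
  using dual_space_add[of f "- g"] dual_space_minus[of g] by simp

lemma dual_space_zero: "0 \<in> dual_space H"
  by (simp add: dual_space_def)

lemma dual_space_sum:
  assumes "\<And>a. a \<in> A \<Longrightarrow> f a \<in> dual_space H"
  shows "sum f A \<in> dual_space H"
  using assms
proof (induction A rule: infinite_finite_induct)
  case (insert x F)
  then show ?case using dual_space_add[of "f x" "sum f F"] by (metis insertCI sum.insert)
qed (simp_all add: dual_space_zero)

lemma dual_space_ext:
  assumes "f \<in> dual_space H" "g \<in> dual_space H" "\<And>h. h \<in> H \<Longrightarrow> f h = g h"
  shows "f = g"
proof
  fix x show "f x = g x"
    using assms unfolding dual_space_def by (cases "x \<in> H") simp_all
qed

lemma weight_space_zero: "weight_space H 0 = H"
proof
  show "weight_space H 0 \<subseteq> H"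
    by (rule subsetI, rule cartan_self_centralizing) (simp add: weight_space_def)
  show "H \<subseteq> weight_space H 0"
    by (rule subsetI) (simp add: weight_space_def cartan_abelian)
qed

lemma rootI:
  assumes "f \<in> dual_space H" "f \<noteq> 0" "v \<in> weight_space H f" "v \<noteq> 0"
  shows "f \<in> roots H"
  using assms by (auto simp: roots_def weight_space_def)

lemma rootE:
  assumes "\<alpha> \<in> roots H"
  obtains v where "\<alpha> \<in> dual_space H" "\<alpha> \<noteq> 0" "v \<in> weight_space H \<alpha>" "v \<noteq> 0"
  using assms by (auto simp: roots_def weight_space_def)

text \<open>
  A function that records the eigenvalues of a nonzero vector is automatically linear, so it becomes
  an element of the dual space once it is extended by zero outside \<open>H\<close>.
\<close>

lemma weight_linear:
  assumes "v \<noteq> 0" "\<And>h. h \<in> H \<Longrightarrow> \<exists>c. bracket h v = c *s v"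
  obtains g where "g \<in> dual_space H" "v \<in> weight_space H g"
proof -
  obtain c where c: "bracket h v = c h *s v" if "h \<in> H" for h using assms(2) by metis
  define g where "g h = (if h \<in> H then c h else 0)" for h
  have v: "v \<in> weight_space H g" using c by (auto simp: weight_space_def g_def)
  have "c (x + y) = c x + c y" if "x \<in> H" "y \<in> H" for x y
  proof -
    have "x + y \<in> H" using subspace_cartan that by (rule subspace_add)
    then have "c (x + y) *s v = (c x + c y) *s v"
      using c that bracket_add_left[of x y v] by (simp add: scale_left_distrib)
    then show ?thesis using assms(1) by simp
  qed
  moreover have "c (a *s x) = a * c x" if "x \<in> H" for x a
  proof -
    have "a *s x \<in> H" using subspace_cartan that by (rule subspace_scale)
    then have "c (a *s x) *s v = (a * c x) *s v"
      using c that bracket_scale_left[of a x v] by simp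
    then show ?thesis using assms(1) by simp
  qed
  ultimately have "g \<in> dual_space H"
    using subspace_cartan by (auto simp: dual_space_def g_def subspace_def)
  then show ?thesis using v that by blast
qed

text \<open>
  Only finitely many operators have to be diagonalized simultaneously, namely those of a basis of
  \<open>H\<close>: an eigenvector of all of them is an eigenvector of their linear combinations.
\<close>

lemma weight_spaces_span: "span (\<Union>f\<in>dual_space H. weight_space H f) = UNIV"
proof -
  obtain T where T: "T \<subseteq> H" "independent T" "H \<subseteq> span T"
    using maximal_independent_subset[of H] by metis
  have "finite T" using T(2) finiteI_independent by blast
  then have span: "span (\<Union>f. weight_space T f) = UNIV"
    using T(1) by (intro simultaneous_eigenvectors_span) (auto intro: cartan_abelian cartan_diagonalizable)
  have "v \<in> (\<Union>f\<in>dual_space H. weight_space H f)" if v: "v \<in> weight_space T f" for v f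
  proof (cases "v = 0")
    case True
    then show ?thesis using dual_space_zero by (auto simp: weight_space_def)
  next
    case False
    have "subspace {h. \<exists>c. bracket h v = c *s v}"
      unfolding subspace_def
    proof (intro conjI ballI allI)
      show "0 \<in> {h. \<exists>c. bracket h v = c *s v}" by (simp add: exI[of _ 0])
    next
      fix h h' assume "h \<in> {h. \<exists>c. bracket h v = c *s v}" "h' \<in> {h. \<exists>c. bracket h v = c *s v}"
      then obtain c c' where "bracket h v = c *s v" "bracket h' v = c' *s v" by blast
      then have "bracket (h + h') v = (c + c') *s v"
        by (simp add: bracket_add_left scale_left_distrib)
      then show "h + h' \<in> {h. \<exists>c. bracket h v = c *s v}" by blast
    next
      fix a h assume "h \<in> {h. \<exists>c. bracket h v = c *s v}"
      then obtain c where "bracket h v = c *s v" by blast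
      then have "bracket (a *s h) v = (a * c) *s v" by (simp add: bracket_scale_left)
      then show "a *s h \<in> {h. \<exists>c. bracket h v = c *s v}" by blast
    qed
    moreover have "T \<subseteq> {h. \<exists>c. bracket h v = c *s v}"
      using v by (auto simp: weight_space_def)
    ultimately have "span T \<subseteq> {h. \<exists>c. bracket h v = c *s v}"
      by (intro span_minimal)
    then have "\<exists>c. bracket h v = c *s v" if "h \<in> H" for h
      using T(3) that by blast
    then show ?thesis using weight_linear[OF False] by blast
  qed
  then have "(\<Union>f. weight_space T f) \<subseteq> (\<Union>f\<in>dual_space H. weight_space H f)" by blast
  then show ?thesis using span span_mono by blast
qed

lemma weight_vectors_zero:
  assumes "finite C" "C \<subseteq> dual_space H" "\<And>f. f \<in> C \<Longrightarrow> u f \<in> weight_space H f"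
    and "(\<Sum>f\<in>C. u f) = 0" "f \<in> C"
  shows "u f = 0"
proof (rule weight_vectors_independent[OF assms(1,3) _ assms(4,5)])
  fix f g assume fg: "f \<in> C" "g \<in> C" "f \<noteq> g"
  show "\<exists>h\<in>H. f h \<noteq> g h"
  proof (rule ccontr)
    assume "\<not> ?thesis"
    then have "f = g" using fg assms(2) by (intro dual_space_ext) auto
    then show False using fg by simp
  qed
qed

lemma weight_unique:
  assumes "v \<in> weight_space H f" "v \<in> weight_space H g" "v \<noteq> 0" "f \<in> dual_space H" "g \<in> dual_space H"
  shows "f = g"
proof (rule dual_space_ext)
  fix h assume "h \<in> H"
  then have "bracket h v = f h *s v" "bracket h v = g h *s v"
    using assms(1,2) unfolding weight_space_def by blast+
  then have "f h *s v = g h *s v" by metis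
  then show "f h = g h" using assms(3) by simp
qed (use assms in auto)

text \<open>
  Nonzero vectors from distinct root spaces are linearly independent, and the algebra has finite
  dimension.
\<close>

lemma finite_roots: "finite (roots H)"
proof -
  define u where "u \<alpha> = (SOME v. v \<in> weight_space H \<alpha> \<and> v \<noteq> 0)" for \<alpha>
  have u: "u \<alpha> \<in> weight_space H \<alpha> \<and> u \<alpha> \<noteq> 0" if \<alpha>: "\<alpha> \<in> roots H" for \<alpha>
  proof -
    obtain v where "v \<in> weight_space H \<alpha>" "v \<noteq> 0" using rootE[OF \<alpha>] by metis
    then show ?thesis unfolding u_def by (intro someI_ex[where P = "\<lambda>v. v \<in> weight_space H \<alpha> \<and> v \<noteq> 0"]) metis
  qed
  have dual: "roots H \<subseteq> dual_space H" by (auto simp: roots_def)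
  have inj: "inj_on u (roots H)"
  proof (rule inj_onI)
    fix \<alpha> \<beta> assume \<alpha>: "\<alpha> \<in> roots H" and \<beta>: "\<beta> \<in> roots H" and eq: "u \<alpha> = u \<beta>"
    show "\<alpha> = \<beta>"
      using u[OF \<alpha>] u[OF \<beta>] \<alpha> \<beta> dual eq by (intro weight_unique[of "u \<alpha>"]) auto
  qed
  have "independent (u ` roots H)"
    unfolding independent_explicit_finite_subsets
  proof (intro allI impI ballI)
    fix S f v assume S: "S \<subseteq> u ` roots H" "finite S" and sum0: "(\<Sum>v\<in>S. f v *s v) = 0" and v: "v \<in> S"
    obtain C where C: "C \<subseteq> roots H" "finite C" "S = u ` C"
      using finite_subset_image[OF S(2,1)] by blast
    obtain \<alpha> where \<alpha>: "\<alpha> \<in> C" "v = u \<alpha>" using C v by blast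
    have "f (u \<alpha>) *s u \<alpha> = 0"
    proof (rule weight_vectors_zero[OF C(2)])
      show "(\<Sum>\<alpha>\<in>C. f (u \<alpha>) *s u \<alpha>) = 0"
        using sum0 sum.reindex[OF inj_on_subset[OF inj C(1)], of "\<lambda>v. f v *s v"] C(3) by simp
      show "f (u \<beta>) *s u \<beta> \<in> weight_space H \<beta>" if "\<beta> \<in> C" for \<beta>
        using u C(1) that by (intro subspace_scale[OF subspace_weight_space]) auto
    qed (use C(1) dual \<alpha> in auto)
    then show "f v = 0" using u C(1) \<alpha> by auto
  qed
  then have "finite (u ` roots H)" by (rule finiteI_independent)
  then show ?thesis using inj finite_imageD by blast
qed

lemma weight_cases:
  assumes "f \<in> dual_space H" "v \<in> weight_space H f" "v \<noteq> 0"
  shows "f = 0 \<or> f \<in> roots H"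
  using assms rootI by blast

lemma iterate_weight:
  assumes "x \<in> weight_space H \<alpha>" "v \<in> weight_space H f"
  shows "(bracket x ^^ n) v \<in> weight_space H (f + fscale (of_nat n) \<alpha>)"
proof (induction n)
  case 0
  then show ?case using assms by (simp add: fscale_def plus_fun_def)
next
  case (Suc n)
  have "\<alpha> + (f + fscale (of_nat n) \<alpha>) = f + fscale (of_nat (Suc n)) \<alpha>"
    by (auto simp: fscale_def algebra_simps fun_eq_iff)
  then show ?case using weight_space_bracket[OF assms(1) Suc.IH] by (simp only: funpow.simps o_apply)
qed

lemma weight_string_finite:
  assumes "\<alpha> \<in> dual_space H" "\<alpha> \<noteq> 0" "f \<in> dual_space H"
  shows "finite {n. f + fscale (of_nat n) \<alpha> \<in> insert 0 (roots H)}"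
proof -
  obtain h where h: "\<alpha> h \<noteq> 0" using assms(2) by (auto simp: fun_eq_iff)
  have "inj (\<lambda>n. f + fscale (of_nat n) \<alpha>)"
  proof (rule injI)
    fix m n :: nat assume "f + fscale (of_nat m) \<alpha> = f + fscale (of_nat n) \<alpha>"
    then have "f h + of_nat m * \<alpha> h = f h + of_nat n * \<alpha> h"
      unfolding fscale_def plus_fun_def by (rule fun_cong)
    then show "m = n" using h by simp
  qed
  then have "finite ((\<lambda>n. f + fscale (of_nat n) \<alpha>) -` insert 0 (roots H))"
    using finite_roots by (intro finite_vimageI) auto
  then show ?thesis by (simp add: vimage_def)
qed

text \<open>
  The weights \<open>f + n \<alpha>\<close> are distinct, so only finitely many of them are roots or zero, and the iterates
  of \<open>ad x\<close> eventually leave the set of weights.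
\<close>

lemma root_vector_nilpotent:
  assumes "\<alpha> \<in> dual_space H" "\<alpha> \<noteq> 0" "x \<in> weight_space H \<alpha>" "f \<in> dual_space H" "v \<in> weight_space H f"
  shows "\<exists>n. (bracket x ^^ n) v = 0"
proof -
  obtain n where n: "f + fscale (of_nat n) \<alpha> \<notin> insert 0 (roots H)"
    using ex_new_if_finite[OF infinite_UNIV_nat weight_string_finite[OF assms(1,2,4)]] by blast
  have "f + fscale (of_nat n) \<alpha> \<in> dual_space H"
    using assms by (intro dual_space_add dual_space_fscale)
  then show ?thesis
    using n weight_cases iterate_weight[OF assms(3,5), of n] by blast
qed

text \<open>
  The value of \<open>\<alpha>\<close> at \<open>[x, y]\<close> is arbitrary here: that it vanishes only for \<open>[x, y] = 0\<close> is a consequence of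
  the first equation.
\<close>

lemma root_string:
  assumes "\<alpha> \<in> dual_space H" "\<alpha> \<noteq> 0" "x \<in> weight_space H \<alpha>" "y \<in> weight_space H (- \<alpha>)"
    and "f \<in> dual_space H" "v \<in> weight_space H f" "v \<noteq> 0"
  obtains p k where "f (bracket x y) + of_nat p * \<alpha> (bracket x y) = of_nat k * \<alpha> (bracket x y) / 2"
    "\<And>j. j \<le> k \<Longrightarrow> (bracket y ^^ j) ((bracket x ^^ p) v) \<noteq> 0"
proof -
  have hH: "bracket x y \<in> H"
    using weight_space_bracket[OF assms(3,4)] weight_space_zero by simp
  then have sl2: "sl2_triple x y (bracket x y) (\<alpha> (bracket x y))"
    using assms(3,4) by (simp add: sl2_triple_def weight_space_def)
  have fv: "bracket (bracket x y) v = f (bracket x y) *s v"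
    using assms(6) hH by (simp add: weight_space_def)
  obtain n where n: "(bracket x ^^ n) v = 0"
    using root_vector_nilpotent[OF assms(1-3,5,6)] by blast
  have "- \<alpha> \<noteq> 0" using assms(2) by (metis neg_equal_0_iff_equal)
  then have "\<exists>n. (bracket y ^^ n) ((bracket x ^^ p) v) = 0" for p
    using root_vector_nilpotent[OF dual_space_minus[OF assms(1)] _ assms(4)
        dual_space_add[OF assms(5) dual_space_fscale[OF assms(1)]] iterate_weight[OF assms(3,6), of p]]
    by blast
  then show ?thesis
    using sl2_string[OF sl2 fv assms(7) n] that by metis
qed

text \<open>
  The factor \<open>q = k / 2 - p\<close> is read off from the \<open>\<alpha>\<close>-string through \<open>f\<close>.
\<close>

lemma weight_real_multiple:
  assumes "\<alpha> \<in> dual_space H" "\<alpha> \<noteq> 0" "x \<in> weight_space H \<alpha>" "y \<in> weight_space H (- \<alpha>)"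
    and "f \<in> dual_space H" "v \<in> weight_space H f" "v \<noteq> 0"
  shows "\<exists>q::real. f (bracket x y) = of_real q * \<alpha> (bracket x y)"
proof -
  obtain p k where "f (bracket x y) + of_nat p * \<alpha> (bracket x y) = of_nat k * \<alpha> (bracket x y) / 2"
    using root_string[OF assms] by metis
  then have "f (bracket x y) = of_real (real k / 2 - real p) * \<alpha> (bracket x y)"
    by (simp add: algebra_simps)
  then show ?thesis by blast
qed

text \<open>
  Such an \<open>h\<close> commutes with all weight vectors, hence is central.
\<close>

lemma cartan_element_zero:
  assumes "h \<in> H" "\<And>\<beta>. \<beta> \<in> roots H \<Longrightarrow> \<beta> h = 0"
  shows "h = 0"
proof (rule center_trivial)
  have "subspace {x. bracket h x = 0}"
    by (auto simp: subspace_def bracket_simps)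
  moreover have "(\<Union>f\<in>dual_space H. weight_space H f) \<subseteq> {x. bracket h x = 0}"
  proof safe
    fix f x assume fx: "f \<in> dual_space H" "x \<in> weight_space H f"
    show "bracket h x = 0"
    proof (cases "x = 0")
      case False
      then have "f h = 0" using weight_cases[OF fx] assms(2) by auto
      then show ?thesis using fx assms(1) by (simp add: weight_space_def)
    qed simp
  qed
  ultimately show "bracket h x = 0" for x
    using span_minimal weight_spaces_span by blast
qed

text \<open>
  Otherwise all weights, being multiples of the value of \<open>\<alpha>\<close>, would vanish at \<open>[x, y]\<close>.
\<close>

lemma sl2_cartan_nonzero:
  assumes "\<alpha> \<in> roots H" "x \<in> weight_space H \<alpha>" "y \<in> weight_space H (- \<alpha>)" "bracket x y \<noteq> 0"
  shows "\<alpha> (bracket x y) \<noteq> 0"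
proof
  assume 0: "\<alpha> (bracket x y) = 0"
  have \<alpha>: "\<alpha> \<in> dual_space H" "\<alpha> \<noteq> 0" using assms(1) unfolding roots_def by blast+
  have "bracket x y \<in> H"
    using weight_space_bracket[OF assms(2,3)] weight_space_zero by simp
  moreover have "\<beta> (bracket x y) = 0" if \<beta>: "\<beta> \<in> roots H" for \<beta>
    using rootE[OF \<beta>] weight_real_multiple[OF \<alpha> assms(2,3)] 0 by (metis mult_zero_right)
  ultimately show False using cartan_element_zero assms(4) by blast
qed

lemma weight_basis:
  obtains B \<phi> where "independent B" "span B = UNIV" "finite B"
    "\<And>b. b \<in> B \<Longrightarrow> \<phi> b \<in> dual_space H" "\<And>b. b \<in> B \<Longrightarrow> b \<in> weight_space H (\<phi> b)"
proof -
  let ?V = "\<Union>f\<in>dual_space H. weight_space H f"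
  obtain B where B: "B \<subseteq> ?V" "independent B" "?V \<subseteq> span B"
    using maximal_independent_subset[of ?V] by metis
  then have "span B = UNIV"
    using weight_spaces_span span_minimal subspace_span by blast
  moreover have "finite B" using B finiteI_independent by blast
  moreover obtain \<phi> where "\<forall>b\<in>B. \<phi> b \<in> dual_space H \<and> b \<in> weight_space H (\<phi> b)"
    using B(1) by (metis (no_types, lifting) UN_E subsetD)
  ultimately show ?thesis using B that by blast
qed

lemma killing_cartan:
  assumes "h \<in> H" "independent B" "span B = UNIV" "finite B" "\<And>b. b \<in> B \<Longrightarrow> b \<in> weight_space H (\<phi> b)"
  shows "killing_form h h = (\<Sum>b\<in>B. (\<phi> b h)\<^sup>2)"
proof -
  have "representation B (bracket h (bracket h b)) b = (\<phi> b h)\<^sup>2" if "b \<in> B" for b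
    using assms that
    by (simp add: weight_space_def bracket_scale_right representation_scale representation_basis span_base power2_eq_square)
  then show ?thesis
    unfolding killing_form_def trace_basis[OF assms(2-4) linear_bracket_bracket] by simp
qed

text \<open>
  This plays the part of Cartan's criterion. Suppose the form vanishes. For opposite root vectors
  \<open>x\<close>, \<open>y\<close> of weights \<open>\<alpha>\<close>, \<open>-\<alpha>\<close> put \<open>h = [x, y]\<close>. The weights take at \<open>h\<close> real multiples \<open>q \<alpha>(h)\<close> of
  \<open>\<alpha>(h)\<close>, so \<open>0 = \<kappa>(h, h) = \<alpha>(h)\<^sup>2 \<Sum> q\<^sup>2\<close>, the sum running over a basis of weight vectors. As
  \<open>\<alpha>(h) \<noteq> 0\<close> unless \<open>h = 0\<close>, all weights vanish at \<open>h\<close>, so that \<open>h\<close> is central and thus zero. Hence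
  opposite root spaces commute, and the sum \<open>U\<close> of all root spaces contains every bracket. It is then
  a nonzero ideal, hence everything, whereas its intersection with \<open>H\<close> is zero by independence of
  weights. So \<open>H = 0\<close>, which is impossible: \<open>H\<close> is its own centralizer, and the algebra is not zero.
\<close>

lemma killing_nonzero: "\<exists>x y. killing_form x y \<noteq> 0"
proof (rule ccontr)
  assume "\<not> (\<exists>x y. killing_form x y \<noteq> 0)"
  then have K: "killing_form x y = 0" for x y by blast
  have opposite: "bracket x y = 0"
    if \<alpha>: "\<alpha> \<in> roots H" and x: "x \<in> weight_space H \<alpha>" and y: "y \<in> weight_space H (- \<alpha>)" for \<alpha> x y
  proof (rule ccontr)
    assume nz: "bracket x y \<noteq> 0"
    have \<alpha>': "\<alpha> \<in> dual_space H" "\<alpha> \<noteq> 0" using \<alpha> unfolding roots_def by blast+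
    have hH: "bracket x y \<in> H"
      using weight_space_bracket[OF x y] weight_space_zero by simp
    obtain B \<phi> where B: "independent B" "span B = UNIV" "finite B"
      "\<And>b. b \<in> B \<Longrightarrow> \<phi> b \<in> dual_space H" "\<And>b. b \<in> B \<Longrightarrow> b \<in> weight_space H (\<phi> b)"
      using weight_basis by blast
    have "b \<noteq> 0" if "b \<in> B" for b using that B(1) dependent_zero by blast
    then have "\<exists>q::real. \<phi> b (bracket x y) = of_real q * \<alpha> (bracket x y)" if "b \<in> B" for b
      using weight_real_multiple[OF \<alpha>' x y] B that by blast
    then obtain q :: "_ \<Rightarrow> real" where q: "\<phi> b (bracket x y) = of_real (q b) * \<alpha> (bracket x y)" if "b \<in> B" for b
      by metis
    have "0 = (\<Sum>b\<in>B. (\<phi> b (bracket x y))\<^sup>2)"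
      using killing_cartan[OF hH B(1-3,5)] K by simp
    also have "\<dots> = of_real (\<Sum>b\<in>B. (q b)\<^sup>2) * (\<alpha> (bracket x y))\<^sup>2"
      by (simp add: q power_mult_distrib sum_distrib_right)
    finally have "(\<Sum>b\<in>B. (q b)\<^sup>2) = 0"
      using sl2_cartan_nonzero[OF \<alpha> x y nz] by (metis mult_eq_0_iff of_real_eq_0_iff power_not_zero)
    then have "q b = 0" if "b \<in> B" for b
      using B(3) that by (simp add: sum_nonneg_eq_0_iff)
    then have "B \<subseteq> {v. bracket (bracket x y) v = 0}"
      using B(5) q hH by (auto simp: weight_space_def)
    moreover have "subspace {v. bracket (bracket x y) v = 0}"
      by (auto simp: subspace_def bracket_simps)
    ultimately have "bracket (bracket x y) v = 0" for v
      using span_minimal B(2) by blast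
    then show False using nz center_trivial by blast
  qed
  let ?U = "span (\<Union>f\<in>roots H. weight_space H f)"
  let ?V = "\<Union>f\<in>dual_space H. weight_space H f"
  \<comment> \<open>A bracket of weight vectors can only fall outside \<open>U\<close> if its weight is zero, and then it vanishes.\<close>
  have gen: "bracket x y \<in> ?U"
    if f: "f \<in> dual_space H" "x \<in> weight_space H f" and g: "g \<in> dual_space H" "y \<in> weight_space H g" for x y f g
  proof (cases "bracket x y = 0")
    case True
    then show ?thesis by (simp add: span_zero)
  next
    case False
    then have "x \<noteq> 0" by auto
    have "f + g \<noteq> 0"
    proof
      assume "f + g = 0"
      then have g_eq: "g = - f" by (simp add: eq_neg_iff_add_eq_0 add.commute)
      show False
      proof (cases "f = 0")
        case True
        then show False using False f g g_eq weight_space_zero cartan_abelian by simp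
      next
        case nz: False
        then show False using False opposite[of f x y] f g g_eq weight_cases[OF f \<open>x \<noteq> 0\<close>] by simp
      qed
    qed
    then have "f + g \<in> roots H"
      using rootI[OF dual_space_add] weight_space_bracket f g False by blast
    then show ?thesis using weight_space_bracket[OF f(2) g(2)] by (intro span_base) blast
  qed
  have "?V \<subseteq> {x. bracket x y \<in> ?U}" if "y \<in> ?V" for y
    using gen that by blast
  moreover have "subspace {x. bracket x y \<in> ?U}" for y
    by (auto simp: subspace_def bracket_simps span_zero span_add span_scale)
  ultimately have "bracket x y \<in> ?U" if "y \<in> ?V" for x y
    using weight_spaces_span that span_minimal by (metis (no_types, lifting) UNIV_I mem_Collect_eq subsetD)
  moreover have "subspace {y. bracket x y \<in> ?U}" for x
    by (auto simp: subspace_def bracket_simps span_zero span_add span_scale)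
  ultimately have U: "bracket x y \<in> ?U" for x y
    using weight_spaces_span span_minimal[of ?V "{y. bracket x y \<in> ?U}"] by blast
  have "lie_ideal ?U" using U by (auto simp: lie_ideal_def)
  moreover have "?U \<noteq> {0}" using U nonabelian by blast
  ultimately have "?U = UNIV" using ideal_trivial by blast
  have "H \<subseteq> {0}"
  proof
    fix h assume h: "h \<in> H"
    have "- h \<in> ?U" using \<open>?U = UNIV\<close> by simp
    then obtain u where u: "\<And>f. f \<in> roots H \<Longrightarrow> u f \<in> weight_space H f" "- h = (\<Sum>f\<in>roots H. u f)"
      using span_weight_spaces_sum[OF finite_roots] by blast
    have n: "0 \<notin> roots H" by (auto simp: roots_def)
    \<comment> \<open>The relation \<open>h + \<Sum> u = 0\<close> is one between vectors of distinct weights, with \<open>h\<close> of weight zero.\<close>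
    define u' where "u' = u(0 := h)"
    have eq: "(\<Sum>f\<in>roots H. u' f) = (\<Sum>f\<in>roots H. u f)"
      unfolding u'_def using n by (intro sum.cong) auto
    have "u' 0 = 0"
    proof (rule weight_vectors_zero[where C = "insert 0 (roots H)"])
      show "(\<Sum>f\<in>insert 0 (roots H). u' f) = 0"
        using n finite_roots u(2)[symmetric] eq by (simp add: u'_def)
      show "insert 0 (roots H) \<subseteq> dual_space H" by (auto simp: roots_def dual_space_zero)
    qed (use u h finite_roots weight_space_zero in \<open>auto simp: u'_def\<close>)
    then show "h \<in> {0}" by (simp add: u'_def)
  qed
  then have "x \<in> H" for x
    by (intro cartan_self_centralizing) auto
  then show False using \<open>H \<subseteq> {0}\<close> nonabelian by (metis bracket_zero_left singletonD subsetD)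
qed

text \<open>
  The radical of the Killing form is an ideal by invariance, and it is proper by \<open>killing_nonzero\<close>.
\<close>

lemma killing_nondegenerate:
  assumes "\<And>y. killing_form x y = 0"
  shows "x = 0"
proof -
  let ?R = "{x. \<forall>y. killing_form x y = 0}"
  have "killing_form (bracket z x) y = 0" if "x \<in> ?R" for x y z
    using that bracket_swap[of z x] killing_invariant[of x z y] killing_scale_left[of "-1" "bracket x z" y] by simp
  then have "lie_ideal ?R"
    by (auto simp: lie_ideal_def subspace_def killing_add_left killing_scale_left)
  then have "?R = {0} \<or> ?R = UNIV" by (rule ideal_trivial)
  moreover have "?R \<noteq> UNIV" using killing_nonzero by blast
  ultimately show ?thesis using assms by blast
qed

lemma killing_weight_orthogonal:
  assumes "f \<in> dual_space H" "g \<in> dual_space H" "x \<in> weight_space H f" "y \<in> weight_space H g" "f + g \<noteq> 0"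
  shows "killing_form x y = 0"
proof -
  have "\<exists>h\<in>H. (f + g) h \<noteq> 0"
    using dual_space_ext[OF dual_space_add[OF assms(1,2)] dual_space_zero] assms(5) by force
  then obtain h where h: "h \<in> H" "(f + g) h \<noteq> 0" by blast
  have "f h * killing_form x y = killing_form (bracket h x) y"
    using assms h by (simp add: weight_space_def killing_scale_left)
  also have "\<dots> = - killing_form (bracket x h) y"
    using bracket_swap[of h x] killing_scale_left[of "-1" "bracket x h" y] by simp
  also have "\<dots> = - (g h * killing_form x y)"
    using assms h by (simp add: killing_invariant weight_space_def killing_scale_right)
  finally have "(f h + g h) * killing_form x y = 0"
    by (simp add: distrib_right)
  then show ?thesis using h by simp
qed

lemma killing_bracket_cartan:
  assumes "x \<in> weight_space H \<alpha>" "y \<in> weight_space H (- \<alpha>)" "h \<in> H"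
  shows "killing_form (bracket x y) h = \<alpha> h * killing_form x y"
proof -
  have "bracket y h = \<alpha> h *s y"
    using assms bracket_swap[of y h] by (simp add: weight_space_def)
  then show ?thesis by (simp add: killing_invariant killing_scale_right)
qed

text \<open>
  A root vector \<open>x\<close> pairs nontrivially with something, and by orthogonality of weight spaces with
  some \<open>y\<close> of weight \<open>-\<alpha>\<close>. Then \<open>\<kappa>([x, y], h) = \<alpha>(h) \<kappa>(x, y)\<close> shows \<open>[x, y] \<noteq> 0\<close>, so \<open>\<alpha>\<close> does not vanish
  there and \<open>y\<close> can be rescaled.
\<close>

lemma root_sl2_triple:
  assumes "\<alpha> \<in> roots H"
  obtains x y where "x \<in> weight_space H \<alpha>" "y \<in> weight_space H (- \<alpha>)" "killing_form x y \<noteq> 0" "\<alpha> (bracket x y) = 2"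
proof -
  obtain x where x: "\<alpha> \<in> dual_space H" "\<alpha> \<noteq> 0" "x \<in> weight_space H \<alpha>" "x \<noteq> 0"
    using assms by (rule rootE)
  have "\<exists>y\<in>weight_space H (- \<alpha>). killing_form x y \<noteq> 0"
  proof (rule ccontr)
    assume *: "\<not> ?thesis"
    have "(\<Union>f\<in>dual_space H. weight_space H f) \<subseteq> {y. killing_form x y = 0}"
    proof safe
      fix f y assume f: "f \<in> dual_space H" "y \<in> weight_space H f"
      show "killing_form x y = 0"
      proof (cases "\<alpha> + f = 0")
        case True
        then have "f = - \<alpha>" by (simp add: eq_neg_iff_add_eq_0 add.commute)
        then show ?thesis using * f by blast
      next
        case False
        then show ?thesis using killing_weight_orthogonal x f by blast
      qed
    qed
    moreover have "subspace {y. killing_form x y = 0}"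
      by (auto simp: subspace_def killing_add_right killing_scale_right)
    ultimately have "killing_form x y = 0" for y
      using span_minimal weight_spaces_span by blast
    then show False using killing_nondegenerate x(4) by blast
  qed
  then obtain y where y: "y \<in> weight_space H (- \<alpha>)" "killing_form x y \<noteq> 0" by blast
  obtain h where h: "h \<in> H" "\<alpha> h \<noteq> 0"
    using dual_space_ext[OF x(1) dual_space_zero] x(2) by force
  have "bracket x y \<noteq> 0"
    using killing_bracket_cartan[OF x(3) y(1) h(1)] h y by auto
  then have c: "\<alpha> (bracket x y) \<noteq> 0"
    using sl2_cartan_nonzero[OF assms x(3) y(1)] by simp
  define c where "c = 2 / \<alpha> (bracket x y)"
  have hH: "bracket x y \<in> H"
    using weight_space_bracket[OF x(3) y(1)] weight_space_zero by simp
  show ?thesis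
  proof (rule that[OF x(3)])
    show "c *s y \<in> weight_space H (- \<alpha>)" using y by (intro subspace_scale[OF subspace_weight_space])
    show "killing_form x (c *s y) \<noteq> 0" using y c by (simp add: killing_scale_right c_def)
    show "\<alpha> (bracket x (c *s y)) = 2"
      using x(1) hH c by (simp add: bracket_scale_right dual_space_def c_def)
  qed
qed

section \<open>Coroots and reflections of roots\<close>

lemma dual_space_scale: "f \<in> dual_space H \<Longrightarrow> h \<in> H \<Longrightarrow> f (c *s h) = c * f h"
  by (simp add: dual_space_def)

lemma opposite_bracket_cartan:
  "x \<in> weight_space H \<alpha> \<Longrightarrow> y \<in> weight_space H (- \<alpha>) \<Longrightarrow> bracket x y \<in> H"
  using weight_space_bracket[of x H \<alpha> y "- \<alpha>"] by (simp add: weight_space_zero)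

lemma killing_cartan_nondegenerate:
  assumes "h \<in> H" "\<And>h'. h' \<in> H \<Longrightarrow> killing_form h h' = 0"
  shows "h = 0"
proof (rule cartan_element_zero[OF assms(1)])
  fix \<beta> assume "\<beta> \<in> roots H"
  then obtain x y where xy: "x \<in> weight_space H \<beta>" "y \<in> weight_space H (- \<beta>)" "killing_form x y \<noteq> 0"
    using root_sl2_triple by metis
  have "\<beta> h * killing_form x y = killing_form h (bracket x y)"
    using killing_bracket_cartan[OF xy(1,2) assms(1)] killing_commute by metis
  also have "\<dots> = 0" using assms(2) opposite_bracket_cartan[OF xy(1,2)] by metis
  finally show "\<beta> h = 0" using xy(3) by simp
qed

lemma killing_rep_eqI:
  assumes "t \<in> H" "\<And>h. h \<in> H \<Longrightarrow> killing_form t h = f h"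
  shows "killing_rep H f = t"
  unfolding killing_rep_def
proof (rule the_equality)
  show "t \<in> H \<and> (\<forall>h\<in>H. killing_form t h = f h)" using assms by blast
next
  fix t' assume t': "t' \<in> H \<and> (\<forall>h\<in>H. killing_form t' h = f h)"
  have "t' - t = 0"
  proof (rule killing_cartan_nondegenerate)
    show "t' - t \<in> H" using t' assms(1) by (intro subspace_diff[OF subspace_cartan]) auto
    show "killing_form (t' - t) h = 0" if "h \<in> H" for h
      using killing_add_left[of "t' - t" t h] t' assms that by simp
  qed
  then show "t' = t" by simp
qed

text \<open>
  By invariance \<open>[x, y]\<close> is \<open>\<kappa>(x, y)\<close> times the Killing representative of \<open>\<alpha>\<close>, and the condition
  \<open>\<alpha>([x, y]) = 2\<close> fixes the same multiple of it as the definition of the coroot. So the strings of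
  the triple of \<open>\<alpha>\<close> describe the reflection in \<open>\<alpha>\<close>.
\<close>

lemma coroot_eq_bracket:
  assumes \<alpha>: "\<alpha> \<in> roots H" and x: "x \<in> weight_space H \<alpha>" and y: "y \<in> weight_space H (- \<alpha>)"
    and k: "killing_form x y \<noteq> 0" and two: "\<alpha> (bracket x y) = 2"
  shows "coroot H \<alpha> = bracket x y"
proof -
  let ?k = "killing_form x y" and ?h = "bracket x y"
  have hH: "?h \<in> H" using opposite_bracket_cartan[OF x y] .
  have K: "killing_form ?h h = \<alpha> h * ?k" if "h \<in> H" for h
    using killing_bracket_cartan[OF x y that] .
  have rep: "killing_rep H \<alpha> = (1 / ?k) *s ?h"
    using subspace_scale[OF subspace_cartan hH] K k
    by (intro killing_rep_eqI) (simp_all add: killing_scale_left)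
  have "dual_form H \<alpha> \<alpha> = 2 / ?k"
    using K[OF hH] k two by (simp add: dual_form_def rep killing_scale_left killing_scale_right)
  then show "coroot H \<alpha> = ?h"
    using k by (simp add: coroot_def rep)
qed

lemma root_coroot_triple:
  assumes "\<alpha> \<in> roots H"
  obtains x y where "x \<in> weight_space H \<alpha>" "y \<in> weight_space H (- \<alpha>)" "killing_form x y \<noteq> 0"
    "bracket x y = coroot H \<alpha>" "\<alpha> (coroot H \<alpha>) = 2"
proof -
  obtain x y where xy: "x \<in> weight_space H \<alpha>" "y \<in> weight_space H (- \<alpha>)" "killing_form x y \<noteq> 0"
    "\<alpha> (bracket x y) = 2"
    using root_sl2_triple[OF assms] by metis
  then show ?thesis using coroot_eq_bracket[OF assms xy] that by metis
qed

lemma root_coroot: "\<alpha> \<in> roots H \<Longrightarrow> \<alpha> (coroot H \<alpha>) = 2"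
  using root_coroot_triple by metis

lemma coroot_in_cartan: "\<alpha> \<in> roots H \<Longrightarrow> coroot H \<alpha> \<in> H"
  using root_coroot_triple opposite_bracket_cartan by metis

lemma root_in_dual: "\<alpha> \<in> roots H \<Longrightarrow> \<alpha> \<in> dual_space H"
  and root_nonzero: "\<alpha> \<in> roots H \<Longrightarrow> \<alpha> \<noteq> 0"
  unfolding roots_def by blast+

text \<open>
  Raising \<open>v\<close> by \<open>p\<close> steps and lowering the result by \<open>p + n\<close> steps ends at the reflected weight. The string
  has \<open>k = n + 2 p\<close> steps below its top, which suffices when \<open>n\<close> is not negative.
\<close>

lemma string_reflection:
  assumes "\<alpha> \<in> dual_space H" "\<alpha> \<noteq> 0" "x \<in> weight_space H \<alpha>" "y \<in> weight_space H (- \<alpha>)"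
    and two: "\<alpha> (bracket x y) = 2"
    and f: "f \<in> dual_space H" "v \<in> weight_space H f" "v \<noteq> 0"
  obtains n :: int where "f (bracket x y) = of_int n"
    "0 \<le> n \<Longrightarrow> \<exists>u. u \<in> weight_space H (f - fscale (of_int n) \<alpha>) \<and> u \<noteq> 0"
proof -
  obtain p k where pk: "f (bracket x y) + of_nat p * \<alpha> (bracket x y) = of_nat k * \<alpha> (bracket x y) / 2"
    and nz: "\<And>j. j \<le> k \<Longrightarrow> (bracket y ^^ j) ((bracket x ^^ p) v) \<noteq> 0"
    using root_string[OF assms(1-4) f] by metis
  define n where "n = int k - 2 * int p"
  have n: "f (bracket x y) = of_int n"
    using pk two by (simp add: n_def algebra_simps)
  have "\<exists>u. u \<in> weight_space H (f - fscale (of_int n) \<alpha>) \<and> u \<noteq> 0" if pos: "0 \<le> n"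
  proof -
    let ?j = "p + nat n"
    have "f + fscale (of_nat p) \<alpha> + fscale (of_nat ?j) (- \<alpha>) = f - fscale (of_int n) \<alpha>"
      using pos by (auto simp: fun_eq_iff fscale_def algebra_simps)
    then have "(bracket y ^^ ?j) ((bracket x ^^ p) v) \<in> weight_space H (f - fscale (of_int n) \<alpha>)"
      using iterate_weight[OF assms(4) iterate_weight[OF assms(3) f(2), of p], of ?j] by metis
    moreover have "?j \<le> k" using pos by (simp add: n_def)
    ultimately show ?thesis using nz by metis
  qed
  then show ?thesis using that n by blast
qed

text \<open>
  When the pairing of \<open>\<beta>\<close> with the coroot is negative, the roles of \<open>x\<close> and \<open>y\<close> are exchanged,
  which replaces \<open>\<alpha>\<close> by \<open>-\<alpha>\<close>.
\<close>

lemma reflected_root: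
  assumes \<alpha>: "\<alpha> \<in> roots H" and \<beta>: "\<beta> \<in> roots H"
  shows "\<beta> - fscale (\<beta> (coroot H \<alpha>)) \<alpha> \<in> roots H"
proof -
  obtain x y where xy: "x \<in> weight_space H \<alpha>" "y \<in> weight_space H (- \<alpha>)"
    and h: "bracket x y = coroot H \<alpha>" and two: "\<alpha> (coroot H \<alpha>) = 2"
    using root_coroot_triple[OF \<alpha>] by metis
  note \<alpha>' = root_in_dual[OF \<alpha>] root_nonzero[OF \<alpha>]
  obtain v where v: "v \<in> weight_space H \<beta>" "v \<noteq> 0" using rootE[OF \<beta>] by metis
  note \<beta>' = root_in_dual[OF \<beta>]
  have "\<alpha> (bracket x y) = 2" using h two by simp
  from string_reflection[OF \<alpha>' xy this \<beta>' v]
  obtain n :: int where n: "\<beta> (bracket x y) = of_int n"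
    and up: "0 \<le> n \<Longrightarrow> \<exists>u. u \<in> weight_space H (\<beta> - fscale (of_int n) \<alpha>) \<and> u \<noteq> 0" by metis
  have down: "\<exists>u. u \<in> weight_space H (\<beta> - fscale (of_int n) \<alpha>) \<and> u \<noteq> 0" if "n < 0"
  proof -
    have swap: "bracket y x = (-1) *s coroot H \<alpha>" using bracket_swap[of x y] h by simp
    have "(- \<alpha>) (bracket y x) = 2"
      using dual_space_scale[OF \<alpha>'(1) coroot_in_cartan[OF \<alpha>], of "-1"] two swap by simp
    moreover have "- \<alpha> \<noteq> 0" using \<alpha>'(2) by (metis neg_equal_0_iff_equal)
    moreover have "x \<in> weight_space H (- (- \<alpha>))" using xy by simp
    ultimately obtain m :: int where m: "\<beta> (bracket y x) = of_int m"
      and um: "0 \<le> m \<Longrightarrow> \<exists>u. u \<in> weight_space H (\<beta> - fscale (of_int m) (- \<alpha>)) \<and> u \<noteq> 0"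
      using string_reflection[OF dual_space_minus[OF \<alpha>'(1)] _ xy(2) _ _ \<beta>' v] by metis
    have "of_int m = - (of_int n :: complex)"
      using dual_space_scale[OF \<beta>' coroot_in_cartan[OF \<alpha>], of "-1"] swap m n h by simp
    then have mn: "m = - n" by (metis of_int_eq_iff of_int_minus)
    have "\<beta> - fscale (of_int m) (- \<alpha>) = \<beta> - fscale (of_int n) \<alpha>"
      by (auto simp: fun_eq_iff fscale_def mn)
    then show ?thesis using um mn that by simp
  qed
  obtain u where u: "u \<in> weight_space H (\<beta> - fscale (of_int n) \<alpha>)" "u \<noteq> 0"
    using up down by (meson not_le)
  have "\<beta> - fscale (of_int n) \<alpha> \<noteq> 0"
  proof
    assume 0: "\<beta> - fscale (of_int n) \<alpha> = 0"
    then have "\<beta> (coroot H \<alpha>) - of_int n * \<alpha> (coroot H \<alpha>) = 0"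
      by (metis fscale_def minus_apply zero_fun_apply)
    then have "n = 0" using n h two by simp
    then show False using 0 root_nonzero[OF \<beta>] by (simp add: fscale_def fun_eq_iff)
  qed
  then have "\<beta> - fscale (of_int n) \<alpha> \<in> roots H"
    using u dual_space_diff[OF \<beta>' dual_space_fscale[OF \<alpha>'(1)]] by (intro rootI)
  then show ?thesis using n h by simp
qed

text \<open>
  Brackets of \<open>\<alpha>\<close>-vectors with \<open>y\<close> are determined by their Killing product with \<open>y\<close>, so a suitable \<open>w = u - c x\<close>
  commutes with \<open>y\<close>. It would be a lowest weight vector of weight \<open>2 > 0\<close>, which is
  impossible unless \<open>w = 0\<close>.
\<close>

lemma root_space_one_dimensional:
  assumes \<alpha>: "\<alpha> \<in> roots H" and x: "x \<in> weight_space H \<alpha>" and y: "y \<in> weight_space H (- \<alpha>)"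
    and k: "killing_form x y \<noteq> 0" and h: "bracket x y = coroot H \<alpha>"
    and u: "u \<in> weight_space H \<alpha>"
  shows "\<exists>c. u = c *s x"
proof (rule ccontr)
  assume *: "\<not> ?thesis"
  define c where "c = killing_form u y / killing_form x y"
  define w where "w = u - c *s x"
  have "w \<noteq> 0" using * by (auto simp: w_def)
  have w: "w \<in> weight_space H \<alpha>"
    unfolding w_def by (intro subspace_diff subspace_scale subspace_weight_space u x)
  have wy: "bracket w y = 0"
  proof (rule killing_cartan_nondegenerate)
    show "bracket w y \<in> H" using opposite_bracket_cartan[OF w y] .
    fix h' assume h': "h' \<in> H"
    have "killing_form u y = killing_form w y + c * killing_form x y"
      using killing_add_left[of w "c *s x" y] by (simp add: w_def killing_scale_left)
    then have "killing_form w y = 0" using k by (simp add: c_def)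
    then show "killing_form (bracket w y) h' = 0"
      using killing_bracket_cartan[OF w y h'] by simp
  qed
  have two: "\<alpha> (coroot H \<alpha>) = 2" and hH: "coroot H \<alpha> \<in> H"
    using root_coroot[OF \<alpha>] coroot_in_cartan[OF \<alpha>] .
  have "sl2_triple x y (coroot H \<alpha>) 2"
    using x y h hH two by (simp add: sl2_triple_def weight_space_def)
  then have sl2: "sl2_triple y x (- coroot H \<alpha>) 2" by (rule sl2_triple_swap)
  have top: "bracket y w = 0" using wy bracket_swap[of w y] by simp
  have wt: "bracket (- coroot H \<alpha>) w = - 2 *s w"
    using w hH two by (simp add: weight_space_def bracket_minus_left)
  obtain n where n: "(bracket x ^^ n) w = 0"
    using root_vector_nilpotent[OF root_in_dual[OF \<alpha>] root_nonzero[OF \<alpha>] x root_in_dual[OF \<alpha>] w] by metis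
  obtain m :: nat where "- 2 = (of_nat m * 2 / 2 :: complex)"
    using sl2_highest_weight[OF sl2 top wt \<open>w \<noteq> 0\<close> n] by metis
  then have "Re (- 2) = Re (of_nat m)" by simp
  then show False by simp
qed

text \<open>
  Let \<open>K \<alpha>\<close> be the largest multiple that is a root and \<open>v\<close> a vector in its root space. If \<open>K \<ge> 2\<close>,
  then \<open>v\<close> is a highest weight vector of weight \<open>2 K\<close> for the triple of \<open>\<alpha>\<close>, and lowering it \<open>K - 1\<close> times
  gives a vector in the root space of \<open>\<alpha>\<close>, that is, a multiple of \<open>x\<close>. So \<open>x\<close> kills it, whereas
  \<open>sl2_raise_lowered\<close> says that raising it gives a nonzero multiple of the previous vector.
\<close>

lemma root_multiple:
  assumes \<alpha>: "\<alpha> \<in> roots H" and k: "fscale (of_nat k) \<alpha> \<in> roots H"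
  shows "k = 1"
proof (rule ccontr)
  assume "k \<noteq> 1"
  define S where "S = {k::nat. fscale (of_nat k) \<alpha> \<in> roots H}"
  note \<alpha>' = root_in_dual[OF \<alpha>] root_nonzero[OF \<alpha>]
  have "S \<subseteq> {n. 0 + fscale (of_nat n) \<alpha> \<in> insert 0 (roots H)}"
    unfolding S_def add_0_left by blast
  then have fin: "finite S"
    using weight_string_finite[OF \<alpha>' dual_space_zero] finite_subset by blast
  have "k \<noteq> 0" using root_nonzero[OF k] by (intro notI) (simp add: fscale_def fun_eq_iff)
  have kS: "k \<in> S" using k by (simp add: S_def)
  define K where "K = Max S"
  have KS: "K \<in> S" and Kmax: "Suc K \<notin> S"
  proof -
    show "K \<in> S" unfolding K_def using fin kS by (intro Max_in) blast+
    show "Suc K \<notin> S" using Max_ge[OF fin, of "Suc K"] unfolding K_def[symmetric] by (intro notI) simp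
  qed
  have "k \<le> K" using fin kS by (simp add: K_def)
  then have "K \<ge> 2" using \<open>k \<noteq> 1\<close> \<open>k \<noteq> 0\<close> by simp
  then obtain r where "K = 2 + r" using le_Suc_ex by blast
  then have r: "K = Suc (Suc r)" by simp
  obtain x y where x: "x \<in> weight_space H \<alpha>" and y: "y \<in> weight_space H (- \<alpha>)"
    and kf: "killing_form x y \<noteq> 0" and h: "bracket x y = coroot H \<alpha>" and two: "\<alpha> (coroot H \<alpha>) = 2"
    using root_coroot_triple[OF \<alpha>] by metis
  have hH: "coroot H \<alpha> \<in> H" using coroot_in_cartan[OF \<alpha>] .
  have sl2: "sl2_triple x y (coroot H \<alpha>) 2"
    using x y h hH two by (simp add: sl2_triple_def weight_space_def)
  have root: "fscale (of_nat K) \<alpha> \<in> roots H" using KS by (simp add: S_def)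
  obtain v where v: "v \<in> weight_space H (fscale (of_nat K) \<alpha>)" "v \<noteq> 0" using rootE[OF root] by metis
  have top: "bracket x v = 0"
  proof (rule ccontr)
    assume nz: "bracket x v \<noteq> 0"
    have eq: "\<alpha> + fscale (of_nat K) \<alpha> = fscale (of_nat (Suc K)) \<alpha>"
      by (auto simp: fscale_def algebra_simps fun_eq_iff)
    have in_ws: "bracket x v \<in> weight_space H (fscale (of_nat (Suc K)) \<alpha>)"
      using weight_space_bracket[OF x v(1)] unfolding eq .
    have "\<alpha> (coroot H \<alpha>) * of_nat (Suc K) \<noteq> 0" unfolding two by (simp only: mult_eq_0_iff of_nat_eq_0_iff) simp
    then have "fscale (of_nat (Suc K)) \<alpha> \<noteq> 0" unfolding fscale_def fun_eq_iff zero_fun_apply by (metis mult.commute)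
    then have "fscale (of_nat (Suc K)) \<alpha> \<in> roots H"
      using rootI[OF dual_space_fscale[OF \<alpha>'(1)] _ in_ws nz] by metis
    then show False using Kmax unfolding S_def by blast
  qed
  have wt: "bracket (coroot H \<alpha>) v = (of_nat K * 2) *s v"
    using v(1) hH two by (simp add: weight_space_def fscale_def)
  have neg: "- \<alpha> \<noteq> 0" using \<alpha>'(2) by (metis neg_equal_0_iff_equal)
  obtain n where n: "(bracket y ^^ n) v = 0"
    using root_vector_nilpotent[OF dual_space_minus[OF \<alpha>'(1)] neg y root_in_dual[OF root] v(1)] by metis
  obtain m :: nat where m: "of_nat K * 2 = (of_nat m * 2 / 2 :: complex)"
    and nz: "\<And>j. j \<le> m \<Longrightarrow> (bracket y ^^ j) v \<noteq> 0"
    using sl2_highest_weight[OF sl2 top wt v(2) n] by metis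
  have "(of_nat m :: complex) = of_nat (2 * K)" using m by (simp add: mult.commute)
  then have "m = 2 * K" by (simp only: of_nat_eq_iff)
  then have nzr: "(bracket y ^^ r) v \<noteq> 0" using nz r by simp
  have eq: "fscale (of_nat K) \<alpha> + fscale (of_nat (Suc r)) (- \<alpha>) = \<alpha>"
    by (auto simp: fscale_def algebra_simps fun_eq_iff r)
  have "(bracket y ^^ Suc r) v \<in> weight_space H \<alpha>"
    using iterate_weight[OF y v(1), of "Suc r"] unfolding eq .
  then obtain c where "(bracket y ^^ Suc r) v = c *s x"
    using root_space_one_dimensional[OF \<alpha> x y kf h] by blast
  then have "bracket x ((bracket y ^^ Suc r) v) = 0"
    by (simp only: bracket_scale_right bracket_self scale_zero_right)
  then have "(of_nat (Suc r) * (of_nat K * 2 - of_nat r * 2 / 2)) *s (bracket y ^^ r) v = 0"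
    using sl2_raise_lowered[OF sl2 top wt, of r] by simp
  then have "of_nat (Suc r) * (of_nat K * 2 - of_nat r * 2 / 2) = (0::complex)"
    using nzr by (simp only: scale_eq_0_iff) simp
  moreover have "of_nat (Suc r) * (of_nat K * 2 - of_nat r * 2 / 2) = (of_nat (Suc r * (r + 4)) :: complex)"
    by (simp add: r algebra_simps)
  ultimately have "(of_nat (Suc r * (r + 4)) :: complex) = 0" by metis
  then show False unfolding of_nat_eq_0_iff by simp
qed

end

section \<open>Simple reflections and positive roots\<close>

locale simple_lie_algebra_with_base = simple_lie_algebra_with_cartan +
  fixes \<Delta> :: "('a \<Rightarrow> complex) set"
  assumes base: "simple_roots H \<Delta>"
begin

lemma base_roots: "\<Delta> \<subseteq> roots H"
  using base unfolding simple_roots_def by (elim conjE)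

lemma base_independent: "fun_space.independent \<Delta>"
  using base unfolding simple_roots_def by (elim conjE)

lemma base_span: "fun_space.span \<Delta> = dual_space H"
  using base unfolding simple_roots_def by (elim conjE)

lemma finite_base: "finite \<Delta>"
  using base_roots finite_roots finite_subset by blast

lemma base_root: "\<alpha> \<in> \<Delta> \<Longrightarrow> \<alpha> \<in> roots H"
  using base_roots by blast

lemma root_expansion:
  assumes "\<beta> \<in> roots H"
  shows "\<exists>c :: ('a \<Rightarrow> complex) \<Rightarrow> nat.
    \<beta> = (\<Sum>\<alpha>\<in>\<Delta>. fscale (of_nat (c \<alpha>)) \<alpha>) \<or> \<beta> = - (\<Sum>\<alpha>\<in>\<Delta>. fscale (of_nat (c \<alpha>)) \<alpha>)"
  using base unfolding simple_roots_def by (elim conjE) (erule bspec[OF _ assms])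

lemma base_coefficients_unique:
  assumes "(\<Sum>\<alpha>\<in>\<Delta>. fscale (a \<alpha>) \<alpha>) = (\<Sum>\<alpha>\<in>\<Delta>. fscale (b \<alpha>) \<alpha>)" "\<alpha> \<in> \<Delta>"
  shows "a \<alpha> = b \<alpha>"
proof -
  have "(\<Sum>\<alpha>\<in>\<Delta>. fscale (a \<alpha> - b \<alpha>) \<alpha>) = (\<Sum>\<alpha>\<in>\<Delta>. fscale (a \<alpha>) \<alpha>) - (\<Sum>\<alpha>\<in>\<Delta>. fscale (b \<alpha>) \<alpha>)"
    by (simp only: fun_space.scale_left_diff_distrib sum_subtractf)
  also have "\<dots> = 0" unfolding assms(1) by (rule diff_self)
  finally have "a \<alpha> - b \<alpha> = 0"
    by (rule fun_space.independentD[OF base_independent finite_base subset_refl _ assms(2)])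
  then show ?thesis by simp
qed

text \<open>
  For a root the rescaled bracket \<open>[x, y]\<close> is a representative; the simple roots span the dual space,
  and representable functionals form a subspace.
\<close>

lemma killing_rep_exists:
  assumes "f \<in> dual_space H"
  shows "\<exists>t\<in>H. \<forall>h\<in>H. killing_form t h = f h"
proof -
  let ?R = "{f. \<exists>t\<in>H. \<forall>h\<in>H. killing_form t h = f h}"
  have "fun_space.subspace ?R"
    unfolding fun_space.subspace_def
  proof (intro conjI ballI allI)
    show "0 \<in> ?R" using subspace_0[OF subspace_cartan] by (auto intro!: bexI[of _ 0])
  next
    fix f g assume "f \<in> ?R" "g \<in> ?R"
    then obtain s t where "s \<in> H" "\<forall>h\<in>H. killing_form s h = f h" "t \<in> H" "\<forall>h\<in>H. killing_form t h = g h"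
      by blast
    then have "s + t \<in> H" "\<forall>h\<in>H. killing_form (s + t) h = (f + g) h"
      by (simp_all add: killing_add_left subspace_add[OF subspace_cartan])
    then show "f + g \<in> ?R" by blast
  next
    fix c f assume "f \<in> ?R"
    then obtain s where "s \<in> H" "\<forall>h\<in>H. killing_form s h = f h" by blast
    then have "c *s s \<in> H" "\<forall>h\<in>H. killing_form (c *s s) h = fscale c f h"
      by (simp_all add: killing_scale_left fscale_def subspace_scale[OF subspace_cartan])
    then show "fscale c f \<in> ?R" by blast
  qed
  moreover have "\<Delta> \<subseteq> ?R"
  proof
    fix \<alpha> assume "\<alpha> \<in> \<Delta>"
    then have \<alpha>: "\<alpha> \<in> roots H" by (rule base_root)
    obtain x y where xy: "x \<in> weight_space H \<alpha>" "y \<in> weight_space H (- \<alpha>)" "killing_form x y \<noteq> 0"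
      using root_coroot_triple[OF \<alpha>] by metis
    have "(1 / killing_form x y) *s bracket x y \<in> H"
      using subspace_scale[OF subspace_cartan opposite_bracket_cartan[OF xy(1,2)]] .
    moreover have "\<forall>h\<in>H. killing_form ((1 / killing_form x y) *s bracket x y) h = \<alpha> h"
      using killing_bracket_cartan[OF xy(1,2)] xy(3) by (simp add: killing_scale_left)
    ultimately show "\<alpha> \<in> ?R" by blast
  qed
  ultimately have "fun_space.span \<Delta> \<subseteq> ?R" by (rule fun_space.span_minimal[rotated])
  then show ?thesis using assms unfolding base_span by blast
qed

lemma
  assumes "f \<in> dual_space H"
  shows killing_rep_cartan: "killing_rep H f \<in> H"
    and killing_rep_form: "h \<in> H \<Longrightarrow> killing_form (killing_rep H f) h = f h"
proof -
  obtain t where t: "t \<in> H" "\<forall>h\<in>H. killing_form t h = f h"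
    using killing_rep_exists[OF assms] by blast
  then have "killing_rep H f = t" by (intro killing_rep_eqI) blast+
  then show "killing_rep H f \<in> H" "h \<in> H \<Longrightarrow> killing_form (killing_rep H f) h = f h"
    using t by simp_all
qed

lemma dual_form_eval: "f \<in> dual_space H \<Longrightarrow> g \<in> dual_space H \<Longrightarrow> dual_form H f g = f (killing_rep H g)"
  unfolding dual_form_def by (rule killing_rep_form[OF _ killing_rep_cartan])

lemma dual_form_commute: "dual_form H f g = dual_form H g f"
  unfolding dual_form_def by (rule killing_commute)

lemma dual_form_diff_scale_left:
  assumes "f \<in> dual_space H" "g \<in> dual_space H" "k \<in> dual_space H"
  shows "dual_form H (f - fscale c g) k = dual_form H f k - c * dual_form H g k"
  using assms by (simp add: dual_form_eval dual_space_diff dual_space_fscale) (simp add: fscale_def)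

lemma reflection_apply: "f \<in> dual_space H \<Longrightarrow> reflection H \<alpha> f = f - fscale (f (coroot H \<alpha>)) \<alpha>"
  by (simp add: reflection_def)

lemma reflection_dual: "\<alpha> \<in> roots H \<Longrightarrow> f \<in> dual_space H \<Longrightarrow> reflection H \<alpha> f \<in> dual_space H"
  by (simp add: reflection_apply dual_space_diff dual_space_fscale root_in_dual)

lemma reflection_involution:
  assumes "\<alpha> \<in> roots H" "f \<in> dual_space H"
  shows "reflection H \<alpha> (reflection H \<alpha> f) = f"
  using reflection_dual[OF assms] assms(2) root_coroot[OF assms(1)]
  by (simp add: reflection_apply fun_eq_iff fscale_def)

lemma reflection_self: "\<alpha> \<in> roots H \<Longrightarrow> reflection H \<alpha> \<alpha> = - \<alpha>"
  using root_coroot[of \<alpha>] by (simp add: reflection_apply root_in_dual fscale_def fun_eq_iff)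

lemma reflection_root: "\<alpha> \<in> roots H \<Longrightarrow> \<beta> \<in> roots H \<Longrightarrow> reflection H \<alpha> \<beta> \<in> roots H"
  by (simp add: reflection_apply root_in_dual reflected_root)

text \<open>
  Reflections are self-adjoint, since \<open>f\<close> pairs with the coroot as \<open>2 (f, \<alpha>) / (\<alpha>, \<alpha>)\<close>.
\<close>

lemma dual_form_reflection:
  assumes \<alpha>: "\<alpha> \<in> roots H" and f: "f \<in> dual_space H" and g: "g \<in> dual_space H"
  shows "dual_form H f (reflection H \<alpha> g) = dual_form H (reflection H \<alpha> f) g"
proof -
  define c where "c = 2 / dual_form H \<alpha> \<alpha>"
  note \<alpha>' = root_in_dual[OF \<alpha>]
  have pair: "k (coroot H \<alpha>) = c * dual_form H k \<alpha>" if "k \<in> dual_space H" for k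
    using that dual_space_scale[OF that killing_rep_cartan[OF \<alpha>']]
    by (simp add: coroot_def c_def dual_form_eval[OF that \<alpha>'])
  have "dual_form H f (reflection H \<alpha> g) = dual_form H (g - fscale (g (coroot H \<alpha>)) \<alpha>) f"
    by (simp add: reflection_apply g dual_form_commute[of f])
  also have "\<dots> = dual_form H g f - c * dual_form H g \<alpha> * dual_form H \<alpha> f"
    by (simp add: dual_form_diff_scale_left[OF g \<alpha>' f] pair[OF g])
  also have "\<dots> = dual_form H f g - c * dual_form H f \<alpha> * dual_form H \<alpha> g"
    by (simp only: dual_form_commute[of g f] dual_form_commute[of \<alpha> f] dual_form_commute[of g \<alpha>] ac_simps)
  also have "\<dots> = dual_form H (reflection H \<alpha> f) g"
    by (simp add: reflection_apply[OF f] dual_form_diff_scale_left[OF f \<alpha>' g] pair[OF f])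
  finally show ?thesis .
qed

lemma positive_root: "\<beta> \<in> positive_roots H \<Delta> \<Longrightarrow> \<beta> \<in> roots H"
  by (simp add: positive_roots_def)

lemma base_combination_single:
  assumes "\<alpha> \<in> \<Delta>"
  shows "(\<Sum>\<gamma>\<in>\<Delta>. fscale (if \<gamma> = \<alpha> then z else 0) \<gamma>) = fscale z \<alpha>"
proof -
  have "(\<Sum>\<gamma>\<in>\<Delta>. fscale (if \<gamma> = \<alpha> then z else 0) \<gamma>) = (\<Sum>\<gamma>\<in>\<Delta>. if \<gamma> = \<alpha> then fscale z \<alpha> else 0)"
    by (intro sum.cong refl) (auto simp: fscale_def fun_eq_iff)
  then show ?thesis using assms finite_base by (simp only: sum.delta) simp
qed

lemma base_subset_positive: "\<alpha> \<in> \<Delta> \<Longrightarrow> \<alpha> \<in> positive_roots H \<Delta>"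
  unfolding positive_roots_def mem_Collect_eq
proof (intro conjI exI[of _ "\<lambda>\<gamma>. if \<gamma> = \<alpha> then 1 else 0"] base_root)
  assume "\<alpha> \<in> \<Delta>"
  have "(\<Sum>\<gamma>\<in>\<Delta>. fscale (of_nat (if \<gamma> = \<alpha> then 1 else 0)) \<gamma>) = (\<Sum>\<gamma>\<in>\<Delta>. fscale (if \<gamma> = \<alpha> then 1 else 0) \<gamma>)"
    by (intro sum.cong refl) simp
  also have "\<dots> = \<alpha>" unfolding base_combination_single[OF \<open>\<alpha> \<in> \<Delta>\<close>] by (simp add: fscale_def)
  finally show "\<alpha> = (\<Sum>\<gamma>\<in>\<Delta>. fscale (of_nat (if \<gamma> = \<alpha> then 1 else 0)) \<gamma>)" by (rule sym)
qed

text \<open>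
  A positive root \<open>\<beta> \<noteq> \<alpha>\<close> has a nonzero coefficient at some simple root \<open>\<gamma> \<noteq> \<alpha>\<close>, for otherwise it would
  be a proper multiple of \<open>\<alpha>\<close>. The reflection changes only the coefficient at \<open>\<alpha>\<close>, so the
  positive coefficient at \<open>\<gamma>\<close> survives; it makes the image positive and different from \<open>\<alpha>\<close>.
\<close>

lemma simple_reflection_positive:
  assumes \<alpha>: "\<alpha> \<in> \<Delta>" and \<beta>: "\<beta> \<in> positive_roots H \<Delta> - {\<alpha>}"
  shows "reflection H \<alpha> \<beta> \<in> positive_roots H \<Delta> - {\<alpha>}"
proof -
  have \<alpha>r: "\<alpha> \<in> roots H" and \<beta>r: "\<beta> \<in> roots H" using \<alpha> \<beta> base_root positive_root by auto
  obtain c :: "_ \<Rightarrow> nat" where c: "\<beta> = (\<Sum>\<gamma>\<in>\<Delta>. fscale (of_nat (c \<gamma>)) \<gamma>)"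
    using \<beta> unfolding positive_roots_def by blast
  define z where "z = \<beta> (coroot H \<alpha>)"
  have "\<exists>\<gamma>\<in>\<Delta>. \<gamma> \<noteq> \<alpha> \<and> c \<gamma> \<noteq> 0"
  proof (rule ccontr)
    assume "\<not> ?thesis"
    then have "\<beta> = (\<Sum>\<gamma>\<in>\<Delta>. fscale (if \<gamma> = \<alpha> then of_nat (c \<alpha>) else 0) \<gamma>)"
      unfolding c by (intro sum.cong refl) auto
    then have \<beta>\<alpha>: "\<beta> = fscale (of_nat (c \<alpha>)) \<alpha>" unfolding base_combination_single[OF \<alpha>] .
    then have "c \<alpha> = 1" using root_multiple[OF \<alpha>r] \<beta>r by metis
    then have "\<beta> = \<alpha>" using \<beta>\<alpha> by (simp add: fscale_def)
    then show False using \<beta> by blast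
  qed
  then obtain \<gamma> where \<gamma>: "\<gamma> \<in> \<Delta>" "\<gamma> \<noteq> \<alpha>" "c \<gamma> \<noteq> 0" by blast
  have s: "reflection H \<alpha> \<beta> = (\<Sum>\<gamma>\<in>\<Delta>. fscale (of_nat (c \<gamma>) - (if \<gamma> = \<alpha> then z else 0)) \<gamma>)"
  proof -
    have "reflection H \<alpha> \<beta> = \<beta> - fscale z \<alpha>"
      unfolding z_def using reflection_apply[OF root_in_dual[OF \<beta>r]] .
    also have "\<dots> = (\<Sum>\<gamma>\<in>\<Delta>. fscale (of_nat (c \<gamma>)) \<gamma>) - (\<Sum>\<gamma>\<in>\<Delta>. fscale (if \<gamma> = \<alpha> then z else 0) \<gamma>)"
      unfolding base_combination_single[OF \<alpha>] c[symmetric] ..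
    finally show ?thesis
      by (simp only: fun_space.scale_left_diff_distrib sum_subtractf)
  qed
  have root: "reflection H \<alpha> \<beta> \<in> roots H" using reflection_root[OF \<alpha>r \<beta>r] .
  obtain d :: "_ \<Rightarrow> nat" where d: "reflection H \<alpha> \<beta> = (\<Sum>\<gamma>\<in>\<Delta>. fscale (of_nat (d \<gamma>)) \<gamma>)
      \<or> reflection H \<alpha> \<beta> = - (\<Sum>\<gamma>\<in>\<Delta>. fscale (of_nat (d \<gamma>)) \<gamma>)"
    using root_expansion[OF root] by (elim exE)
  have "reflection H \<alpha> \<beta> \<noteq> - (\<Sum>\<gamma>\<in>\<Delta>. fscale (of_nat (d \<gamma>)) \<gamma>)"
  proof
    assume "reflection H \<alpha> \<beta> = - (\<Sum>\<gamma>\<in>\<Delta>. fscale (of_nat (d \<gamma>)) \<gamma>)"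
    then have "(\<Sum>\<gamma>\<in>\<Delta>. fscale (of_nat (c \<gamma>) - (if \<gamma> = \<alpha> then z else 0)) \<gamma>)
      = (\<Sum>\<gamma>\<in>\<Delta>. fscale (- of_nat (d \<gamma>)) \<gamma>)"
      unfolding s by (simp only: fun_space.scale_minus_left sum_negf)
    from base_coefficients_unique[OF this \<gamma>(1)]
    have "(of_nat (c \<gamma> + d \<gamma>) :: complex) = 0" using \<gamma>(2) by simp
    then show False using \<gamma>(3) unfolding of_nat_eq_0_iff by simp
  qed
  then have "reflection H \<alpha> \<beta> \<in> positive_roots H \<Delta>"
    using root d unfolding positive_roots_def by blast
  moreover have "reflection H \<alpha> \<beta> \<noteq> \<alpha>"
  proof
    assume "reflection H \<alpha> \<beta> = \<alpha>"
    also have "\<alpha> = (\<Sum>\<gamma>\<in>\<Delta>. fscale (if \<gamma> = \<alpha> then 1 else 0) \<gamma>)"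
      unfolding base_combination_single[OF \<alpha>] by (simp add: fscale_def)
    finally have "(\<Sum>\<gamma>\<in>\<Delta>. fscale (of_nat (c \<gamma>) - (if \<gamma> = \<alpha> then z else 0)) \<gamma>)
      = (\<Sum>\<gamma>\<in>\<Delta>. fscale (if \<gamma> = \<alpha> then 1 else 0) \<gamma>)" unfolding s .
    from base_coefficients_unique[OF this \<gamma>(1)] show False using \<gamma>(2,3) by simp
  qed
  ultimately show ?thesis by blast
qed

section \<open>The antisymmetry of the dimension polynomial\<close>

definition positive_root_product :: "('a \<Rightarrow> complex) \<Rightarrow> complex"
  where "positive_root_product f = (\<Prod>\<beta>\<in>positive_roots H \<Delta>. dual_form H \<beta> f)"

lemma finite_positive_roots: "finite (positive_roots H \<Delta>)"
  by (rule finite_subset[OF _ finite_roots]) (auto simp: positive_roots_def)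

text \<open>
  Self-adjointness moves the reflection from \<open>f\<close> to the roots. There it permutes the factors
  other than \<open>\<alpha>\<close> and changes the sign of the factor of \<open>\<alpha>\<close>.
\<close>

lemma positive_root_product_reflection:
  assumes \<alpha>: "\<alpha> \<in> \<Delta>" and f: "f \<in> dual_space H"
  shows "positive_root_product (reflection H \<alpha> f) = - positive_root_product f"
proof -
  let ?P = "positive_roots H \<Delta>"
  have \<alpha>r: "\<alpha> \<in> roots H" using base_root[OF \<alpha>] .
  note split = prod.remove[OF finite_positive_roots base_subset_positive[OF \<alpha>]]
  have mv: "dual_form H \<beta> (reflection H \<alpha> f) = dual_form H (reflection H \<alpha> \<beta>) f" if "\<beta> \<in> roots H" for \<beta>
    using dual_form_reflection[OF \<alpha>r root_in_dual[OF that] f] .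
  have "(\<Prod>\<beta>\<in>?P - {\<alpha>}. dual_form H \<beta> (reflection H \<alpha> f))
      = (\<Prod>\<beta>\<in>?P - {\<alpha>}. dual_form H (reflection H \<alpha> \<beta>) f)"
    by (intro prod.cong refl mv positive_root) blast
  also have "\<dots> = (\<Prod>\<beta>\<in>?P - {\<alpha>}. dual_form H \<beta> f)"
  proof (rule prod.reindex_bij_witness[where i = "reflection H \<alpha>" and j = "reflection H \<alpha>"])
    fix \<beta> assume \<beta>: "\<beta> \<in> ?P - {\<alpha>}"
    then have "\<beta> \<in> dual_space H" using positive_root root_in_dual by blast
    then show "reflection H \<alpha> (reflection H \<alpha> \<beta>) = \<beta>" "reflection H \<alpha> (reflection H \<alpha> \<beta>) = \<beta>"
      using reflection_involution[OF \<alpha>r] by blast+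
    show "reflection H \<alpha> \<beta> \<in> ?P - {\<alpha>}" "reflection H \<alpha> \<beta> \<in> ?P - {\<alpha>}"
      using simple_reflection_positive[OF \<alpha> \<beta>] by blast+
  qed (rule refl)
  finally have rest: "(\<Prod>\<beta>\<in>?P - {\<alpha>}. dual_form H \<beta> (reflection H \<alpha> f))
      = (\<Prod>\<beta>\<in>?P - {\<alpha>}. dual_form H \<beta> f)" .
  have "dual_form H (reflection H \<alpha> \<alpha>) f = - dual_form H \<alpha> f"
    using root_in_dual[OF \<alpha>r] by (simp add: reflection_self[OF \<alpha>r] dual_form_eval dual_space_minus f)
  then show ?thesis
    unfolding positive_root_product_def split rest by (simp add: mv[OF \<alpha>r])
qed

lemma reflection_Bij: "\<alpha> \<in> roots H \<Longrightarrow> reflection H \<alpha> \<in> Bij (dual_space H)"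
  unfolding Bij_def
proof (intro IntI CollectI)
  assume \<alpha>: "\<alpha> \<in> roots H"
  show "reflection H \<alpha> \<in> extensional (dual_space H)" by (simp add: reflection_def)
  show "bij_betw (reflection H \<alpha>) (dual_space H) (dual_space H)"
    by (rule bij_betw_byWitness[where f' = "reflection H \<alpha>"])
      (use \<alpha> reflection_involution reflection_dual in blast)+
qed

abbreviation "\<B> \<equiv> BijGroup (dual_space H)"

lemma weyl_word_Nil: "weyl_word H [] = \<one>\<^bsub>\<B>\<^esub>"
  by (simp add: weyl_word_def)

lemma weyl_word_Cons: "weyl_word H (\<alpha> # as) = reflection H \<alpha> \<otimes>\<^bsub>\<B>\<^esub> weyl_word H as"
  by (simp add: weyl_word_def)

lemma simple_reflection_carrier: "\<alpha> \<in> \<Delta> \<Longrightarrow> reflection H \<alpha> \<in> carrier \<B>"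
  using reflection_Bij[OF base_root] by (simp add: BijGroup_def)

interpretation bij: group "\<B>"
  by (rule group_BijGroup)

lemma weyl_word_carrier: "set as \<subseteq> \<Delta> \<Longrightarrow> weyl_word H as \<in> carrier \<B>"
  by (induction as) (simp_all add: weyl_word_Nil weyl_word_Cons simple_reflection_carrier)

lemma weyl_word_append:
  "set as \<subseteq> \<Delta> \<Longrightarrow> set bs \<subseteq> \<Delta> \<Longrightarrow> weyl_word H (as @ bs) = weyl_word H as \<otimes>\<^bsub>\<B>\<^esub> weyl_word H bs"
  by (induction as)
    (simp_all add: weyl_word_Nil weyl_word_Cons simple_reflection_carrier weyl_word_carrier bij.m_assoc)

lemma BijGroup_mult_apply:
  "g \<in> carrier \<B> \<Longrightarrow> h \<in> carrier \<B> \<Longrightarrow> f \<in> dual_space H \<Longrightarrow> (g \<otimes>\<^bsub>\<B>\<^esub> h) f = g (h f)"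
  by (simp add: BijGroup_def compose_eq)

lemma simple_reflection_inverse:
  assumes "\<alpha> \<in> \<Delta>"
  shows "inv\<^bsub>\<B>\<^esub> (reflection H \<alpha>) = reflection H \<alpha>"
proof -
  have \<alpha>: "\<alpha> \<in> roots H" and c: "reflection H \<alpha> \<in> Bij (dual_space H)"
    using base_root[OF assms] reflection_Bij by auto
  have "compose (dual_space H) (reflection H \<alpha>) (reflection H \<alpha>) = (\<lambda>f\<in>dual_space H. f)"
    unfolding compose_def using reflection_involution[OF \<alpha>] by (intro restrict_ext)
  then have "reflection H \<alpha> \<otimes>\<^bsub>\<B>\<^esub> reflection H \<alpha> = \<one>\<^bsub>\<B>\<^esub>"
    using c by (simp add: BijGroup_def)
  then show ?thesis
    using bij.inv_equality simple_reflection_carrier[OF assms] by blast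
qed

text \<open>
  Inverses contribute nothing new because the generators are involutions, so every element of the
  generated group is a word and its length is attained by one.
\<close>

lemma weyl_group_word:
  assumes "w \<in> weyl_group H \<Delta>"
  shows "\<exists>as. set as \<subseteq> \<Delta> \<and> weyl_word H as = w"
  using assms unfolding weyl_group_def
proof (induction rule: generate.induct)
  case one
  show ?case using weyl_word_Nil by (intro exI[of _ "[]"]) simp
next
  case (incl h)
  then obtain \<alpha> where \<alpha>: "\<alpha> \<in> \<Delta>" "h = reflection H \<alpha>" by blast
  have "weyl_word H [\<alpha>] = h"
    using \<alpha>
    by (simp add: weyl_word_Cons weyl_word_Nil simple_reflection_carrier)
  then show ?case using \<alpha> by (intro exI[of _ "[\<alpha>]"]) simp
next
  case (inv h)
  then obtain \<alpha> where \<alpha>: "\<alpha> \<in> \<Delta>" "h = reflection H \<alpha>" by blast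
  have "weyl_word H [\<alpha>] = inv\<^bsub>\<B>\<^esub> h"
    using \<alpha>
    by (simp add: weyl_word_Cons weyl_word_Nil simple_reflection_carrier simple_reflection_inverse)
  then show ?case using \<alpha> by (intro exI[of _ "[\<alpha>]"]) simp
next
  case (eng h1 h2)
  then obtain as bs where "set as \<subseteq> \<Delta>" "weyl_word H as = h1" "set bs \<subseteq> \<Delta>" "weyl_word H bs = h2" by blast
  then show ?case using weyl_word_append[of as bs] by (intro exI[of _ "as @ bs"]) simp
qed

lemma weyl_word_sign:
  assumes "set as \<subseteq> \<Delta>" "f \<in> dual_space H"
  shows "weyl_word H as f \<in> dual_space H \<and>
    positive_root_product (weyl_word H as f) = (- 1) ^ length as * positive_root_product f"
  using assms(1)
proof (induction as)
  case Nil
  have "weyl_word H [] f = f" using assms(2) by (simp add: weyl_word_Nil BijGroup_def)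
  then show ?case using assms(2) by simp
next
  case (Cons \<alpha> as)
  then have \<alpha>: "\<alpha> \<in> \<Delta>" and as: "set as \<subseteq> \<Delta>" by auto
  have app: "weyl_word H (\<alpha> # as) f = reflection H \<alpha> (weyl_word H as f)"
    unfolding weyl_word_Cons
    using BijGroup_mult_apply[OF simple_reflection_carrier[OF \<alpha>] weyl_word_carrier[OF as] assms(2)] .
  note IH = Cons.IH[OF as]
  show ?case
    unfolding app
    using reflection_dual[OF base_root[OF \<alpha>] conjunct1[OF IH]]
      positive_root_product_reflection[OF \<alpha> conjunct1[OF IH]] conjunct2[OF IH] by simp
qed

lemma minimal_weyl_word:
  assumes "w \<in> weyl_group H \<Delta>"
  obtains as where "set as \<subseteq> \<Delta>" "length as = weyl_length H \<Delta> w" "weyl_word H as = w"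
proof -
  have "\<exists>n as. set as \<subseteq> \<Delta> \<and> length as = n \<and> weyl_word H as = w"
    using weyl_group_word[OF assms] by blast
  then have "\<exists>as. set as \<subseteq> \<Delta> \<and> length as = weyl_length H \<Delta> w \<and> weyl_word H as = w"
    unfolding weyl_length_def by (rule LeastI_ex)
  then show ?thesis using that by blast
qed

lemma weyl_vector_dual: "weyl_vector H \<Delta> \<in> dual_space H"
  unfolding weyl_vector_def
  by (intro dual_space_fscale dual_space_sum root_in_dual positive_root)

text \<open>
  In the variable \<open>f + \<rho>\<close>, on which the shifted action is the ordinary one, the dimension polynomial is
  a constant multiple of a product of linear forms.
\<close>

lemma dimension_polynomial_quotient:
  "dimension_polynomial H \<Delta> f =
    positive_root_product (f + weyl_vector H \<Delta>) / positive_root_product (weyl_vector H \<Delta>)"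
  unfolding dimension_polynomial_def positive_root_product_def by (rule prod_dividef)

lemma dimension_polynomial_shifted_action:
  assumes "w \<in> weyl_group H \<Delta>" "f \<in> dual_space H"
  shows "dimension_polynomial H \<Delta> (shifted_action H \<Delta> w f)
    = (- 1) ^ weyl_length H \<Delta> w * dimension_polynomial H \<Delta> f"
proof -
  obtain as where as: "set as \<subseteq> \<Delta>" "length as = weyl_length H \<Delta> w" "weyl_word H as = w"
    using minimal_weyl_word[OF assms(1)] .
  have "shifted_action H \<Delta> w f + weyl_vector H \<Delta> = weyl_word H as (f + weyl_vector H \<Delta>)"
    unfolding shifted_action_def as(3) by (rule diff_add_cancel)
  then show ?thesis
    using weyl_word_sign[OF as(1) dual_space_add[OF assms(2) weyl_vector_dual]]
    unfolding dimension_polynomial_quotient as(2) by simp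
qed

end

theorem proposition2p1:
  fixes scale :: "complex \<Rightarrow> 'g::ab_group_add \<Rightarrow> 'g"
    and Basis :: "'g set"
    and bracket :: "'g \<Rightarrow> 'g \<Rightarrow> 'g"
    and H :: "'g set"
    and \<Delta> :: "('g \<Rightarrow> complex) set"
    and w :: "('g \<Rightarrow> complex) \<Rightarrow> 'g \<Rightarrow> complex"
    and \<mu> :: "'g \<Rightarrow> complex"
  assumes "simple_complex_lie_algebra scale Basis bracket"
    and "complex_lie_algebra.cartan_subalgebra scale bracket H"
    and "complex_lie_algebra.simple_roots scale bracket H \<Delta>"
    and "w \<in> complex_lie_algebra.weyl_group scale Basis bracket H \<Delta>"
    and "\<mu> \<in> complex_lie_algebra.dual_space scale H"
  shows "complex_lie_algebra.dimension_polynomial scale Basis bracket H \<Delta>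
           (complex_lie_algebra.shifted_action scale bracket H \<Delta> w \<mu>) =
         (- 1) ^ complex_lie_algebra.weyl_length scale Basis bracket H \<Delta> w *
           complex_lie_algebra.dimension_polynomial scale Basis bracket H \<Delta> \<mu>"
proof -
  interpret simple_complex_lie_algebra scale Basis bracket by fact
  interpret simple_lie_algebra_with_base scale Basis bracket H \<Delta>
    by unfold_locales fact+
  show ?thesis using assms(4,5) by (rule dimension_polynomial_shifted_action)
qed

end
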